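(* Let $\mathcal{K}$ be a $\mu$-AEC (with $\mu$ a regular cardinal) with Löwenheim–Skolem–Tarski number $\lambda = \mathrm{LS}(\mathcal{K})$. Then $\mathcal{K}$, regarded as a category, is a $\lambda^+$-accessible category.
   Context: For an infinite cardinal $\mu$, a $\mu$-ary language $L$ consists of function and relation symbols, each with an arity that is an ordinal $<\mu$; an $L$-structure $M$ has a universe $|M|$, interprets an $n$-ary function symbol as a function ${}^{n}|M| \to |M|$ and an $n$-ary relation symbol as a subset of ${}^{n}|M|$. A $\mu$-abstract class is a pair $(\mathcal{K}, \le_{\mathcal{K}})$ where $\mathcal{K}$ is a class of $L$-structures for a fixed $\mu$-ary language $L = L(\mathcal{K})$, $\le_{\mathcal{K}}$ is a reflexive and transitive relation on $\mathcal{K}$ such that $M \le_{\mathcal{K}} N$ implies $M$ is an $L$-substructure of $N$, and which respects isomorphisms (if $f: N \cong N'$ and $N \in \mathcal{K}$ then $N' \in \mathcal{K}$, and if moreover $M \le_{\mathcal{K}} N$ then $f[M] \in \mathcal{K}$ and $f[M] \le_{\mathcal{K}} N'$). A poset $I$ is $\mu$-directed if every subset of size $<\mu$ has an upper bound. For $\mu$ regular, a $\mu$-abstract class is a $\mu$-AEC if: (Coherence) if $M_0, M_1, M_2 \in \mathcal{K}$, $M_0 \le_{\mathcal{K}} M_2$, $M_1 \le_{\mathcal{K}} M_2$ and $M_0 \subseteq M_1$, then $M_0 \le_{\mathcal{K}} M_1$; (Tarski–Vaught) if $\{M_i : i \in I\} \subseteq \mathcal{K}$ with $I$ $\mu$-directed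 and $i \le j \Rightarrow M_i \le_{\mathcal{K}} M_j$, then (a) $\bigcup_i M_i \in \mathcal{K}$ and $M_j \le_{\mathcal{K}} \bigcup_i M_i$ for all $j$, and (b) if $N \in \mathcal{K}$ with $M_i \le_{\mathcal{K}} N$ for all $i$, then $\bigcup_i M_i \le_{\mathcal{K}} N$; (Löwenheim–Skolem–Tarski) there is a cardinal $\lambda = \lambda^{<\mu} \ge |L(\mathcal{K})| + \mu$ such that for every $M \in \mathcal{K}$ and $A \subseteq |M|$ there is $N \le_{\mathcal{K}} M$ with $A \subseteq |N|$ and $|N| \le |A|^{<\mu} + \lambda$; $\mathrm{LS}(\mathcal{K})$ is the least such $\lambda$. A $\mu$-AEC is regarded as a category whose objects are the members of $\mathcal{K}$ and whose morphisms $M \to N$ are the $\mathcal{K}$-embeddings, i.e. maps $f$ which are $L$-isomorphisms from $M$ onto some $f[M] \le_{\mathcal{K}} N$. For a regular cardinal $\kappa$: an object $M$ of a category $\mathcal{C}$ is $\kappa$-presentable if the hom-functor $\mathcal{C}(M,-)$ preserves $\kappa$-directed colimits (colimits of diagrams indexed by $\kappa$-directed posets); $\mathcal{C}$ is $\kappa$-accessible if it has all $\kappa$-directed colimits and has a set $\mathcal{A}$ of $\kappa$-presentable objects such that every object is a $\kappa$-directed colimit of objects of $\mathcal{A}$. *)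

theory Defs
  imports "HOL-Library.FuncSet"
begin

unbundle cardinal_syntax

text \<open>
  Sets versus classes. HOL has no proper classes, so a type \<^typ>\<open>'u\<close> plays the role of the
  set-theoretic universe: a collection counts as a (small) \<^emph>\<open>set\<close> iff its cardinality is below
  that of \<^typ>\<open>'u\<close>, all structures have a small universe contained in \<^typ>\<open>'u\<close>, and all index posets
  of diagrams are small. Cardinals and ordinals are represented as in the library by
  well-orders; an element \<open>n\<close> of the field of a cardinal \<open>mu\<close> stands for the ordinal given by
  the initial segment \<open>underS mu n\<close>, and every ordinal below \<open>mu\<close> arises in this way exactly once.
\<close>

definition small :: "'u itself \<Rightarrow> 'x set \<Rightarrow> bool" where
  "small _ X \<longleftrightarrow> |X| <o |UNIV :: 'u set|"

text \<open>
  The only demand on the universe: replacement for small families (regularity), and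
  existence of \<open>lam\<close>-th powers of small sets. Every universe of (strongly) inaccessible
  cardinality above \<open>lam\<close> satisfies it, i.e. every Grothendieck universe containing \<open>lam\<close>, but so
  does every universe of cardinality \<open>(2^lam)\<^sup>+\<close>, which needs no large cardinals; see the two
  lemmas below.
\<close>

definition closed_universe :: "'u itself \<Rightarrow> 'c rel \<Rightarrow> bool" where
  "closed_universe U lam \<longleftrightarrow>
     infinite (UNIV :: 'u set) \<and> regularCard |UNIV :: 'u set| \<and>
     (\<forall>A :: 'u set. small U A \<longrightarrow> small U (Field lam \<rightarrow>\<^sub>E A))"

lemma card_PiE_eq_cexp: "|Field lam \<rightarrow>\<^sub>E A| = |A| ^c lam"
proof -
  have "(Field lam \<rightarrow>\<^sub>E A) = Func (Field lam) A"
    unfolding PiE_def Func_def extensional_def by auto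
  then show ?thesis by (simp add: cexp_def Field_card_of)
qed

lemma closed_universe_inaccessible:
  fixes lam :: "'c rel"
  assumes inf: "infinite (UNIV :: 'u set)" and reg: "regularCard |UNIV :: 'u set|"
    and strong_limit: "\<And>A :: 'u set. small TYPE('u) A \<Longrightarrow> small TYPE('u) (Pow A)"
    and lam: "Card_order lam" "lam <o |UNIV :: 'u set|"
  shows "closed_universe TYPE('u) lam"
  unfolding closed_universe_def
proof (intro conjI allI impI inf reg)
  fix A :: "'u set" assume A: "small TYPE('u) A"
  have "|Field lam| =o lam" using lam(1) by (rule card_of_Field_ordIso)
  then have F: "|Field lam| <o |UNIV :: 'u set|" using lam(2) ordIso_ordLess_trans by blast
  let ?P = "Field lam \<times> A"
  have sP: "|?P| <o |UNIV :: 'u set|"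
  proof -
    have "|{x} \<times> A| <o |UNIV :: 'u set|" for x :: 'c
    proof -
      have "{x} \<times> A = Pair x ` A" by auto
      then show ?thesis
        using A card_of_image[of "Pair x" A] ordLeq_ordLess_trans by (auto simp: small_def)
    qed
    moreover have "?P = (\<Union>x\<in>Field lam. {x} \<times> A)" by auto
    ultimately show ?thesis
      using card_of_UNION_ordLess_infinite_Field_regularCard[OF reg _ F, of "\<lambda>x. {x} \<times> A"] inf
      by (simp add: cinfinite_def Field_card_of card_of_card_order_on)
  qed
  then obtain h :: "'c \<times> 'u \<Rightarrow> 'u" where h: "inj_on h ?P"
    by (meson card_of_ordLeq ordLess_imp_ordLeq)
  have "|h ` ?P| <o |UNIV :: 'u set|"
    using sP card_of_image ordLeq_ordLess_trans by blast
  then have sPow: "|Pow (h ` ?P)| <o |UNIV :: 'u set|"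
    using strong_limit by (simp add: small_def)
  let ?G = "\<lambda>f. h ` ((\<lambda>x. (x, f x)) ` Field lam)"
  have "inj_on ?G (Field lam \<rightarrow>\<^sub>E A)"
  proof (rule inj_onI)
    fix f g assume fg: "f \<in> Field lam \<rightarrow>\<^sub>E A" "g \<in> Field lam \<rightarrow>\<^sub>E A" and eq: "?G f = ?G g"
    have "(\<lambda>x. (x, f x)) ` Field lam \<subseteq> ?P" "(\<lambda>x. (x, g x)) ` Field lam \<subseteq> ?P"
      using fg by auto
    then have "(\<lambda>x. (x, f x)) ` Field lam = (\<lambda>x. (x, g x)) ` Field lam"
      by (rule iffD1[OF inj_on_image_eq_iff[OF h] eq])
    then have "\<And>x. x \<in> Field lam \<Longrightarrow> f x = g x" by auto
    then show "f = g" using fg by (intro PiE_ext)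
  qed
  moreover have "?G ` (Field lam \<rightarrow>\<^sub>E A) \<subseteq> Pow (h ` ?P)" by fastforce
  ultimately have "|Field lam \<rightarrow>\<^sub>E A| \<le>o |Pow (h ` ?P)|" using card_of_ordLeq by blast
  then show "small TYPE('u) (Field lam \<rightarrow>\<^sub>E A)"
    using sPow ordLeq_ordLess_trans by (auto simp: small_def)
qed

lemma closed_universe_Suc_power:
  fixes lam :: "'c rel"
  assumes lam: "Cinfinite lam" and card: "|UNIV :: 'u set| =o cardSuc (ctwo ^c lam)"
  shows "closed_universe TYPE('u) lam"
proof -
  have inf2: "Cinfinite (ctwo ^c lam)"
    using Cinfinite_cexp[OF ordLeq_refl[OF Card_order_ctwo] lam] .
  have suc: "Cinfinite (cardSuc (ctwo ^c lam))" using inf2 by (rule Cinfinite_cardSuc)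
  have inf: "Cinfinite |UNIV :: 'u set|"
    using Cinfinite_cong[OF ordIso_symmetric[OF card] suc] .
  have reg: "regularCard |UNIV :: 'u set|"
    using regularCard_ordIso[OF ordIso_symmetric[OF card] suc regularCard_cardSuc[OF inf2]] .
  have "small TYPE('u) (Field lam \<rightarrow>\<^sub>E A)" if A: "small TYPE('u) A" for A :: "'u set"
  proof -
    have "|A| <o cardSuc (ctwo ^c lam)"
      using A card ordLess_ordIso_trans unfolding small_def by blast
    then have "|A| \<le>o ctwo ^c lam"
      using cardSuc_ordLeq_ordLess[OF conjunct2[OF inf2] card_of_Card_order, of A]
      by simp
    then have "|A| ^c lam \<le>o (ctwo ^c lam) ^c lam"
      by (rule cexp_mono1) (use lam in simp)
    also have "(ctwo ^c lam) ^c lam =o ctwo ^c (lam *c lam)"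
      by (rule cexp_cprod[OF Card_order_ctwo])
    also have "ctwo ^c (lam *c lam) =o ctwo ^c lam"
      by (rule cexp_cong2[OF cprod_infinite[OF lam] Card_order_ctwo Card_order_cprod])
    also have "ctwo ^c lam <o cardSuc (ctwo ^c lam)"
      by (rule cardSuc_greater) (use inf2 in simp)
    also have "cardSuc (ctwo ^c lam) =o |UNIV :: 'u set|"
      by (rule ordIso_symmetric[OF card])
    finally show ?thesis by (simp add: small_def card_PiE_eq_cexp)
  qed
  then show ?thesis
    using inf reg unfolding closed_universe_def cinfinite_def by (simp add: Field_card_of)
qed


section \<open>Structures for a \<open>mu\<close>-ary language\<close>

record ('f, 'r, 'k) language =
  funs :: "'f set"
  rels :: "'r set"
  fun_arity :: "'f \<Rightarrow> 'k"
  rel_arity :: "'r \<Rightarrow> 'k"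

definition is_language :: "'k rel \<Rightarrow> ('f, 'r, 'k) language \<Rightarrow> bool" where
  "is_language mu L \<longleftrightarrow>
     (\<forall>s\<in>funs L. fun_arity L s \<in> Field mu) \<and> (\<forall>s\<in>rels L. rel_arity L s \<in> Field mu)"

definition tuples :: "'k rel \<Rightarrow> 'k \<Rightarrow> 'u set \<Rightarrow> ('k \<Rightarrow> 'u) set" where
  "tuples mu n A = underS mu n \<rightarrow>\<^sub>E A"

record ('f, 'r, 'k, 'u) struct =
  univ :: "'u set"
  fun_int :: "'f \<Rightarrow> ('k \<Rightarrow> 'u) \<Rightarrow> 'u"
  rel_int :: "'r \<Rightarrow> ('k \<Rightarrow> 'u) set"

text \<open>
  Interpretations take fixed dummy values outside their proper domain, so that structures
  are equal as soon as they are equal in the mathematical sense.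
\<close>

definition is_struct ::
  "'k rel \<Rightarrow> ('f, 'r, 'k) language \<Rightarrow> ('f, 'r, 'k, 'u) struct \<Rightarrow> bool" where
  "is_struct mu L M \<longleftrightarrow>
     small TYPE('u) (univ M) \<and>
     (\<forall>s\<in>funs L. fun_int M s \<in> tuples mu (fun_arity L s) (univ M) \<rightarrow>\<^sub>E univ M) \<and>
     (\<forall>s. s \<notin> funs L \<longrightarrow> fun_int M s = (\<lambda>_. undefined)) \<and>
     (\<forall>s\<in>rels L. rel_int M s \<subseteq> tuples mu (rel_arity L s) (univ M)) \<and>
     (\<forall>s. s \<notin> rels L \<longrightarrow> rel_int M s = {})"

definition substruct ::
  "'k rel \<Rightarrow> ('f, 'r, 'k) language \<Rightarrow>
   ('f, 'r, 'k, 'u) struct \<Rightarrow> ('f, 'r, 'k, 'u) struct \<Rightarrow> bool" where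
  "substruct mu L M N \<longleftrightarrow>
     is_struct mu L M \<and> is_struct mu L N \<and> univ M \<subseteq> univ N \<and>
     (\<forall>s\<in>funs L. \<forall>x\<in>tuples mu (fun_arity L s) (univ M). fun_int M s x = fun_int N s x) \<and>
     (\<forall>s\<in>rels L. rel_int M s = rel_int N s \<inter> tuples mu (rel_arity L s) (univ M))"

definition is_iso ::
  "'k rel \<Rightarrow> ('f, 'r, 'k) language \<Rightarrow>
   ('u \<Rightarrow> 'u) \<Rightarrow> ('f, 'r, 'k, 'u) struct \<Rightarrow> ('f, 'r, 'k, 'u) struct \<Rightarrow> bool" where
  "is_iso mu L f M N \<longleftrightarrow>
     is_struct mu L M \<and> is_struct mu L N \<and> bij_betw f (univ M) (univ N) \<and>
     (\<forall>s\<in>funs L. \<forall>x\<in>tuples mu (fun_arity L s) (univ M).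
        f (fun_int M s x) = fun_int N s (compose (underS mu (fun_arity L s)) f x)) \<and>
     (\<forall>s\<in>rels L. \<forall>x\<in>tuples mu (rel_arity L s) (univ M).
        x \<in> rel_int M s \<longleftrightarrow> compose (underS mu (rel_arity L s)) f x \<in> rel_int N s)"

text \<open>
  Only used for \<open>mu\<close>-directed systems of substructures with \<open>mu\<close> regular: there every tuple of
  the union lies in some member, and the members agree on its value.
\<close>

definition union_struct ::
  "'k rel \<Rightarrow> ('f, 'r, 'k) language \<Rightarrow>
   'i set \<Rightarrow> ('i \<Rightarrow> ('f, 'r, 'k, 'u) struct) \<Rightarrow> ('f, 'r, 'k, 'u) struct" where
  "union_struct mu L I M =
     \<lparr> univ = (\<Union>i\<in>I. univ (M i)),
       fun_int = (\<lambda>s x.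
         if s \<in> funs L \<and> (\<exists>i\<in>I. x \<in> tuples mu (fun_arity L s) (univ (M i)))
         then THE y. \<exists>i\<in>I. x \<in> tuples mu (fun_arity L s) (univ (M i)) \<and> y = fun_int (M i) s x
         else undefined),
       rel_int = (\<lambda>s. \<Union>i\<in>I. rel_int (M i) s) \<rparr>"


section \<open>\<open>mu\<close>-abstract elementary classes\<close>

definition directed_poset :: "'c rel \<Rightarrow> 'i set \<Rightarrow> 'i rel \<Rightarrow> bool" where
  "directed_poset kappa I r \<longleftrightarrow>
     partial_order_on I r \<and>
     (\<forall>X. X \<subseteq> I \<and> |X| <o kappa \<longrightarrow> (\<exists>b\<in>I. \<forall>x\<in>X. (x, b) \<in> r))"

text \<open>
  In the last clause \<open>M'\<close> is \<open>f[M]\<close>: it is the only structure that \<open>f\<close>, restricted to the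
  universe of \<open>M\<close>, can be an isomorphism onto.
\<close>

definition abstract_class ::
  "'k rel \<Rightarrow> ('f, 'r, 'k) language \<Rightarrow> ('f, 'r, 'k, 'u) struct set \<Rightarrow>
   (('f, 'r, 'k, 'u) struct \<Rightarrow> ('f, 'r, 'k, 'u) struct \<Rightarrow> bool) \<Rightarrow> bool" where
  "abstract_class mu L K le \<longleftrightarrow>
     is_language mu L \<and>
     (\<forall>M\<in>K. is_struct mu L M) \<and>
     (\<forall>M N. le M N \<longrightarrow> M \<in> K \<and> N \<in> K \<and> substruct mu L M N) \<and>
     (\<forall>M\<in>K. le M M) \<and>
     (\<forall>M N P. le M N \<and> le N P \<longrightarrow> le M P) \<and>
     (\<forall>f N N'. is_iso mu L f N N' \<and> N \<in> K \<longrightarrow>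
        N' \<in> K \<and>
        (\<forall>M. le M N \<longrightarrow> (\<exists>M'\<in>K. is_iso mu L f M M' \<and> le M' N')))"

text \<open>
  The sequences in \<open>A\<close> of length \<open>< mu\<close>. Their number is \<open>|A|^{<mu}\<close>; the only difference
  to the supremum of the cardinals \<open>|A|^a\<close> with \<open>a < mu\<close> is for \<open>|A| \<le> 1\<close>, where both are at
  most \<open>mu\<close> and hence absorbed by \<open>lam \<ge> mu\<close> below.
\<close>

definition seqs :: "'k rel \<Rightarrow> 'a set \<Rightarrow> ('k \<times> ('k \<Rightarrow> 'a)) set" where
  "seqs mu A = (SIGMA n : Field mu. tuples mu n A)"

definition LST_cardinal ::
  "'k rel \<Rightarrow> ('f, 'r, 'k) language \<Rightarrow> ('f, 'r, 'k, 'u) struct set \<Rightarrow>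
   (('f, 'r, 'k, 'u) struct \<Rightarrow> ('f, 'r, 'k, 'u) struct \<Rightarrow> bool) \<Rightarrow> 'u rel \<Rightarrow> bool" where
  "LST_cardinal mu L K le lam \<longleftrightarrow>
     Card_order lam \<and> lam <o |UNIV :: 'u set| \<and>
     |seqs mu (Field lam)| =o lam \<and>
     ( |funs L| +c |rels L| ) +c mu \<le>o lam \<and>
     (\<forall>M\<in>K. \<forall>A. A \<subseteq> univ M \<longrightarrow>
        (\<exists>N. le N M \<and> A \<subseteq> univ N \<and> |univ N| \<le>o |seqs mu A| +c lam))"

definition mu_AEC ::
  "'k rel \<Rightarrow> ('f, 'r, 'k) language \<Rightarrow> ('f, 'r, 'k, 'u) struct set \<Rightarrow>
   (('f, 'r, 'k, 'u) struct \<Rightarrow> ('f, 'r, 'k, 'u) struct \<Rightarrow> bool) \<Rightarrow> bool" where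
  "mu_AEC mu L K le \<longleftrightarrow>
     Cinfinite mu \<and> regularCard mu \<and> abstract_class mu L K le \<and>
     (\<forall>M0 M1 M2. M0 \<in> K \<and> M1 \<in> K \<and> M2 \<in> K \<and> le M0 M2 \<and> le M1 M2 \<and> substruct mu L M0 M1
        \<longrightarrow> le M0 M1) \<and>
     (\<forall>(I :: 'u set) r M.
        small TYPE('u) I \<and> directed_poset mu I r \<and> (\<forall>i\<in>I. M i \<in> K) \<and>
        (\<forall>i j. (i, j) \<in> r \<longrightarrow> le (M i) (M j)) \<longrightarrow>
          union_struct mu L I M \<in> K \<and>
          (\<forall>j\<in>I. le (M j) (union_struct mu L I M)) \<and>
          (\<forall>N\<in>K. (\<forall>i\<in>I. le (M i) N) \<longrightarrow> le (union_struct mu L I M) N)) \<and>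
     (\<exists>lam. LST_cardinal mu L K le lam)"

definition is_LS ::
  "'k rel \<Rightarrow> ('f, 'r, 'k) language \<Rightarrow> ('f, 'r, 'k, 'u) struct set \<Rightarrow>
   (('f, 'r, 'k, 'u) struct \<Rightarrow> ('f, 'r, 'k, 'u) struct \<Rightarrow> bool) \<Rightarrow> 'u rel \<Rightarrow> bool" where
  "is_LS mu L K le lam \<longleftrightarrow>
     LST_cardinal mu L K le lam \<and> (\<forall>lam'. LST_cardinal mu L K le lam' \<longrightarrow> lam \<le>o lam')"


section \<open>Accessible categories\<close>

text \<open>
  \<open>Comp C X Y Z g f\<close> is the composite of \<open>f : X \<rightarrow> Y\<close> and \<open>g : Y \<rightarrow> Z\<close>. Hom-sets of different
  pairs of objects need not be disjoint.
\<close>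

record ('o, 'm) category =
  Obj :: "'o set"
  Hom :: "'o \<Rightarrow> 'o \<Rightarrow> 'm set"
  Id :: "'o \<Rightarrow> 'm"
  Comp :: "'o \<Rightarrow> 'o \<Rightarrow> 'o \<Rightarrow> 'm \<Rightarrow> 'm \<Rightarrow> 'm"

definition is_category :: "('o, 'm) category \<Rightarrow> bool" where
  "is_category C \<longleftrightarrow>
     (\<forall>X\<in>Obj C. Id C X \<in> Hom C X X) \<and>
     (\<forall>X\<in>Obj C. \<forall>Y\<in>Obj C. \<forall>Z\<in>Obj C. \<forall>f\<in>Hom C X Y. \<forall>g\<in>Hom C Y Z.
        Comp C X Y Z g f \<in> Hom C X Z) \<and>
     (\<forall>X\<in>Obj C. \<forall>Y\<in>Obj C. \<forall>f\<in>Hom C X Y.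
        Comp C X X Y f (Id C X) = f \<and> Comp C X Y Y (Id C Y) f = f) \<and>
     (\<forall>W\<in>Obj C. \<forall>X\<in>Obj C. \<forall>Y\<in>Obj C. \<forall>Z\<in>Obj C.
        \<forall>f\<in>Hom C W X. \<forall>g\<in>Hom C X Y. \<forall>h\<in>Hom C Y Z.
          Comp C W Y Z h (Comp C W X Y g f) = Comp C W X Z (Comp C X Y Z h g) f)"

definition diagram ::
  "('o, 'm) category \<Rightarrow> 'i set \<Rightarrow> 'i rel \<Rightarrow> ('i \<Rightarrow> 'o) \<Rightarrow> ('i \<Rightarrow> 'i \<Rightarrow> 'm) \<Rightarrow> bool" where
  "diagram C I r D d \<longleftrightarrow>
     (\<forall>i\<in>I. D i \<in> Obj C) \<and>
     (\<forall>i j. (i, j) \<in> r \<longrightarrow> d i j \<in> Hom C (D i) (D j)) \<and>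
     (\<forall>i\<in>I. d i i = Id C (D i)) \<and>
     (\<forall>i j k. (i, j) \<in> r \<and> (j, k) \<in> r \<longrightarrow>
        Comp C (D i) (D j) (D k) (d j k) (d i j) = d i k)"

definition cocone ::
  "('o, 'm) category \<Rightarrow> 'i set \<Rightarrow> 'i rel \<Rightarrow> ('i \<Rightarrow> 'o) \<Rightarrow> ('i \<Rightarrow> 'i \<Rightarrow> 'm) \<Rightarrow>
   'o \<Rightarrow> ('i \<Rightarrow> 'm) \<Rightarrow> bool" where
  "cocone C I r D d c t \<longleftrightarrow>
     c \<in> Obj C \<and> (\<forall>i\<in>I. t i \<in> Hom C (D i) c) \<and>
     (\<forall>i j. (i, j) \<in> r \<longrightarrow> Comp C (D i) (D j) c (t j) (d i j) = t i)"

definition colimit ::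
  "('o, 'm) category \<Rightarrow> 'i set \<Rightarrow> 'i rel \<Rightarrow> ('i \<Rightarrow> 'o) \<Rightarrow> ('i \<Rightarrow> 'i \<Rightarrow> 'm) \<Rightarrow>
   'o \<Rightarrow> ('i \<Rightarrow> 'm) \<Rightarrow> bool" where
  "colimit C I r D d c t \<longleftrightarrow>
     cocone C I r D d c t \<and>
     (\<forall>c' t'. cocone C I r D d c' t' \<longrightarrow>
        (\<exists>!h. h \<in> Hom C c c' \<and> (\<forall>i\<in>I. Comp C (D i) c c' h (t i) = t' i)))"

text \<open>
  The category of all sets with elements in a given type. Colimits of sets are detected by
  maps into sets with at most two elements, so for functors into this category it is
  immaterial that the elements come from one type.
\<close>

definition Set_cat :: "('t set, 't \<Rightarrow> 't) category" where
  "Set_cat =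
     \<lparr> Obj = UNIV, Hom = (\<lambda>X Y. X \<rightarrow>\<^sub>E Y), Id = (\<lambda>X. \<lambda>x\<in>X. x),
       Comp = (\<lambda>X Y Z g f. compose X g f) \<rparr>"

record ('o, 'm, 'p, 'n) functor_data =
  on_obj :: "'o \<Rightarrow> 'p"
  on_hom :: "'o \<Rightarrow> 'o \<Rightarrow> 'm \<Rightarrow> 'n"

definition hom_functor :: "('o, 'm) category \<Rightarrow> 'o \<Rightarrow> ('o, 'm, 'm set, 'm \<Rightarrow> 'm) functor_data" where
  "hom_functor C M =
     \<lparr> on_obj = Hom C M, on_hom = (\<lambda>X Y g. \<lambda>f\<in>Hom C M X. Comp C M X Y g f) \<rparr>"

text \<open>Small posets may be assumed to live on subsets of the universe type \<^typ>\<open>'u\<close>.\<close>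

definition preserves_directed_colimits ::
  "'u itself \<Rightarrow> 'c rel \<Rightarrow> ('o, 'm) category \<Rightarrow> ('p, 'n) category \<Rightarrow>
   ('o, 'm, 'p, 'n) functor_data \<Rightarrow> bool" where
  "preserves_directed_colimits U kappa C E F \<longleftrightarrow>
     (\<forall>(I :: 'u set) r D d c t.
        small U I \<and> directed_poset kappa I r \<and> diagram C I r D d \<and> colimit C I r D d c t \<longrightarrow>
        colimit E I r (\<lambda>i. on_obj F (D i)) (\<lambda>i j. on_hom F (D i) (D j) (d i j))
          (on_obj F c) (\<lambda>i. on_hom F (D i) c (t i)))"

definition presentable :: "'u itself \<Rightarrow> 'c rel \<Rightarrow> ('o, 'm) category \<Rightarrow> 'o \<Rightarrow> bool" where
  "presentable U kappa C M \<longleftrightarrow>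
     M \<in> Obj C \<and> preserves_directed_colimits U kappa C Set_cat (hom_functor C M)"

definition accessible :: "'u itself \<Rightarrow> 'c rel \<Rightarrow> ('o, 'm) category \<Rightarrow> bool" where
  "accessible U kappa C \<longleftrightarrow>
     Cinfinite kappa \<and> regularCard kappa \<and> kappa <o |UNIV :: 'u set| \<and> is_category C \<and>
     (\<forall>(I :: 'u set) r D d.
        small U I \<and> directed_poset kappa I r \<and> diagram C I r D d \<longrightarrow>
        (\<exists>c t. colimit C I r D d c t)) \<and>
     (\<exists>A. A \<subseteq> Obj C \<and> small U A \<and> (\<forall>M\<in>A. presentable U kappa C M) \<and>
        (\<forall>X\<in>Obj C. \<exists>(I :: 'u set) r D d t.
           small U I \<and> directed_poset kappa I r \<and> diagram C I r D d \<and>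
           (\<forall>i\<in>I. D i \<in> A) \<and> colimit C I r D d X t))"


section \<open>A \<open>mu\<close>-AEC as a category\<close>

definition K_embedding ::
  "'k rel \<Rightarrow> ('f, 'r, 'k) language \<Rightarrow>
   (('f, 'r, 'k, 'u) struct \<Rightarrow> ('f, 'r, 'k, 'u) struct \<Rightarrow> bool) \<Rightarrow>
   ('u \<Rightarrow> 'u) \<Rightarrow> ('f, 'r, 'k, 'u) struct \<Rightarrow> ('f, 'r, 'k, 'u) struct \<Rightarrow> bool" where
  "K_embedding mu L le f M N \<longleftrightarrow> (\<exists>M'. is_iso mu L f M M' \<and> le M' N)"

definition AEC_cat ::
  "'k rel \<Rightarrow> ('f, 'r, 'k) language \<Rightarrow> ('f, 'r, 'k, 'u) struct set \<Rightarrow>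
   (('f, 'r, 'k, 'u) struct \<Rightarrow> ('f, 'r, 'k, 'u) struct \<Rightarrow> bool) \<Rightarrow>
   (('f, 'r, 'k, 'u) struct, 'u \<Rightarrow> 'u) category" where
  "AEC_cat mu L K le =
     \<lparr> Obj = K,
       Hom = (\<lambda>M N. {f \<in> extensional (univ M). K_embedding mu L le f M N}),
       Id = (\<lambda>M. \<lambda>x\<in>univ M. x),
       Comp = (\<lambda>M N P g f. compose (univ M) g f) \<rparr>"

end

theory Submission
  imports Defs
begin

text \<open>
  By coherence, a K-embedding into \<open>P\<close> factors through another one as soon as its image is
  contained in the image of the other. With the Tarski-Vaught axioms this gives a description of
  \<open>mu\<close>-directed colimits that does not refer to \<open>K\<close>: a cocone is a colimit iff it is jointly
  surjective. Hence directed colimits are computed as for sets, and a map from a structure of size at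
  most \<open>lam\<close> into a \<open>lam\<^sup>+\<close>-directed colimit has its image in a single stage, so that such a
  structure is \<open>lam\<^sup>+\<close>-presentable. Every \<open>X\<close> is the colimit of its submodels of size at most
  \<open>lam\<close>, which form a \<open>lam\<^sup>+\<close>-directed family by Loewenheim-Skolem since
  \<open>|seqs mu (Field lam)| = lam\<close>. Up to isomorphism these have their universe inside \<open>Field lam\<close>,
  and there are at most \<open>2^lam\<close> such structures.
\<close>

section \<open>Isomorphisms of structures\<close>

lemma tuples_mono: "A \<subseteq> B \<Longrightarrow> tuples mu n A \<subseteq> tuples mu n B"
  by (auto simp: tuples_def PiE_def)

lemma compose_in_tuples:
  "x \<in> tuples mu n A \<Longrightarrow> f ` A \<subseteq> B \<Longrightarrow> compose (underS mu n) f x \<in> tuples mu n B"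
  by (fastforce simp: tuples_def compose_def)

lemma compose_id_tuple:
  assumes "x \<in> tuples mu n A" and "\<And>a. a \<in> A \<Longrightarrow> f a = a"
  shows "compose (underS mu n) f x = x"
  using assms by (auto simp: tuples_def compose_def fun_eq_iff restrict_def PiE_def extensional_def)

lemma compose_compose_tuple:
  "compose (underS mu n) g (compose (underS mu n) f x) = compose (underS mu n) (g \<circ> f) x"
  by (auto simp: compose_def fun_eq_iff)

lemma compose_cong_tuple:
  "x \<in> tuples mu n A \<Longrightarrow> (\<And>a. a \<in> A \<Longrightarrow> f a = g a) \<Longrightarrow>
    compose (underS mu n) f x = compose (underS mu n) g x"
  by (auto simp: compose_def fun_eq_iff tuples_def)

lemma compose_inv_into_tuple:
  assumes "x \<in> tuples mu n (f ` A)"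
  shows "compose (underS mu n) f (compose (underS mu n) (inv_into A f) x) = x"
  unfolding compose_compose_tuple using assms
  by (rule compose_id_tuple) (auto simp: f_inv_into_f)

lemma inv_into_compose_tuple:
  assumes "x \<in> tuples mu n A" "inj_on f A"
  shows "compose (underS mu n) (inv_into A f) (compose (underS mu n) f x) = x"
  unfolding compose_compose_tuple using assms(1)
  by (rule compose_id_tuple) (simp add: assms(2))

section \<open>Structures, their isomorphisms and their images\<close>

lemma is_structD:
  assumes "is_struct mu L M"
  shows "small TYPE('u) (univ (M :: ('f, 'r, 'k, 'u) struct))"
    and "s \<in> funs L \<Longrightarrow> fun_int M s \<in> tuples mu (fun_arity L s) (univ M) \<rightarrow>\<^sub>E univ M"
    and "s \<in> funs L \<Longrightarrow> x \<in> tuples mu (fun_arity L s) (univ M) \<Longrightarrow> fun_int M s x \<in> univ M"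
    and "s \<notin> funs L \<Longrightarrow> fun_int M s = (\<lambda>_. undefined)"
    and "q \<in> rels L \<Longrightarrow> rel_int M q \<subseteq> tuples mu (rel_arity L q) (univ M)"
    and "q \<notin> rels L \<Longrightarrow> rel_int M q = {}"
  using assms by (auto simp: is_struct_def)

text \<open>\<open>is_struct\<close> fixes every value outside the proper symbols and arguments, so
  agreement on the tuples over the universe leaves no freedom.\<close>

lemma struct_eqI:
  assumes M: "is_struct mu L M" and N: "is_struct mu L N" and u: "univ M = univ N"
    and f: "\<And>s x. s \<in> funs L \<Longrightarrow> x \<in> tuples mu (fun_arity L s) (univ M) \<Longrightarrow>
      fun_int M s x = fun_int N s x"
    and r: "\<And>s x. s \<in> rels L \<Longrightarrow> x \<in> tuples mu (rel_arity L s) (univ M) \<Longrightarrow>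
      x \<in> rel_int M s \<longleftrightarrow> x \<in> rel_int N s"
  shows "M = N"
proof -
  have "fun_int M s = fun_int N s" for s
  proof (cases "s \<in> funs L")
    case True
    then show ?thesis
      using is_structD(2)[OF M True] is_structD(2)[OF N True] f[OF True] u by (metis PiE_ext)
  next
    case False
    then show ?thesis using is_structD(4)[OF M False] is_structD(4)[OF N False] by simp
  qed
  moreover have "rel_int M s = rel_int N s" for s
  proof (cases "s \<in> rels L")
    case True
    then show ?thesis
      using is_structD(5)[OF M True] is_structD(5)[OF N True] r[OF True] u
      by (intro set_eqI) (metis subsetD)
  next
    case False
    then show ?thesis using is_structD(6)[OF M False] is_structD(6)[OF N False] by simp
  qed
  ultimately show ?thesis using u by (intro struct.equality ext) auto
qed

lemma is_isoD:
  assumes "is_iso mu L f M N"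
  shows "is_struct mu L M" "is_struct mu L N" "inj_on f (univ M)" "f ` univ M = univ N"
    and "s \<in> funs L \<Longrightarrow> x \<in> tuples mu (fun_arity L s) (univ M) \<Longrightarrow>
      fun_int N s (compose (underS mu (fun_arity L s)) f x) = f (fun_int M s x)"
    and "q \<in> rels L \<Longrightarrow> z \<in> tuples mu (rel_arity L q) (univ M) \<Longrightarrow>
      compose (underS mu (rel_arity L q)) f z \<in> rel_int N q \<longleftrightarrow> z \<in> rel_int M q"
  using assms by (auto simp: is_iso_def bij_betw_def)

lemma is_isoI:
  assumes "is_struct mu L M" "is_struct mu L N" "inj_on f (univ M)" "f ` univ M = univ N"
    and "\<And>s x. s \<in> funs L \<Longrightarrow> x \<in> tuples mu (fun_arity L s) (univ M) \<Longrightarrow>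
      fun_int N s (compose (underS mu (fun_arity L s)) f x) = f (fun_int M s x)"
    and "\<And>s x. s \<in> rels L \<Longrightarrow> x \<in> tuples mu (rel_arity L s) (univ M) \<Longrightarrow>
      compose (underS mu (rel_arity L s)) f x \<in> rel_int N s \<longleftrightarrow> x \<in> rel_int M s"
  shows "is_iso mu L f M N"
  using assms by (auto simp: is_iso_def bij_betw_def)

lemma is_iso_id: "is_struct mu L M \<Longrightarrow> is_iso mu L id M M"
  by (rule is_isoI) (simp_all add: compose_id_tuple)

text \<open>Only the values on the universe matter. This permits passing from a map to its
  restriction, as hom-sets consist of extensional maps.\<close>

lemma is_iso_cong:
  assumes f: "is_iso mu L f M N" and eq: "\<And>a. a \<in> univ M \<Longrightarrow> f a = g a"
  shows "is_iso mu L g M N"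
proof (rule is_isoI)
  show "inj_on g (univ M)" "g ` univ M = univ N"
    using is_isoD(3,4)[OF f] eq by (auto cong: inj_on_cong image_cong)
qed (use is_isoD[OF f] eq compose_cong_tuple[of _ mu _ "univ M" f g] in \<open>auto simp: is_structD(3)\<close>)

lemma is_iso_comp:
  assumes f: "is_iso mu L f M N" and g: "is_iso mu L g N P"
  shows "is_iso mu L (g \<circ> f) M P"
proof (rule is_isoI)
  show "inj_on (g \<circ> f) (univ M)" "(g \<circ> f) ` univ M = univ P"
    using is_isoD(3,4)[OF f] is_isoD(3,4)[OF g] image_comp[of g f "univ M"] by (auto intro: comp_inj_on)
  show "fun_int P s (compose (underS mu (fun_arity L s)) (g \<circ> f) x) = (g \<circ> f) (fun_int M s x)"
    if "s \<in> funs L" "x \<in> tuples mu (fun_arity L s) (univ M)" for s x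
    using is_isoD(5)[OF f that] is_isoD(4)[OF f]
      is_isoD(5)[OF g that(1), of "compose (underS mu (fun_arity L s)) f x"]
      compose_in_tuples[OF that(2), of f "univ N"]
    by (simp add: compose_compose_tuple)
  show "compose (underS mu (rel_arity L s)) (g \<circ> f) x \<in> rel_int P s \<longleftrightarrow> x \<in> rel_int M s"
    if "s \<in> rels L" "x \<in> tuples mu (rel_arity L s) (univ M)" for s x
    using is_isoD(6)[OF f that] is_isoD(4)[OF f]
      is_isoD(6)[OF g that(1), of "compose (underS mu (rel_arity L s)) f x"]
      compose_in_tuples[OF that(2), of f "univ N"]
    by (simp add: compose_compose_tuple)
qed (use is_isoD[OF f] is_isoD[OF g] in auto)

lemma is_iso_inv:
  assumes f: "is_iso mu L f M N"
  shows "is_iso mu L (inv_into (univ M) f) N M"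
proof (rule is_isoI)
  note im = is_isoD(4)[OF f] and inj = is_isoD(3)[OF f]
  let ?g = "inv_into (univ M) f"
  show "inj_on ?g (univ N)" "?g ` univ N = univ M"
    using bij_betw_inv_into[of f "univ M" "univ N"] im inj by (auto simp: bij_betw_def)
  have pull: "compose (underS mu n) ?g y \<in> tuples mu n (univ M)"
    if "y \<in> tuples mu n (univ N)" for y n
    using that im by (intro compose_in_tuples[OF that]) (auto intro: inv_into_into)
  show "fun_int M s (compose (underS mu (fun_arity L s)) ?g y) = ?g (fun_int N s y)"
    if s: "s \<in> funs L" and y: "y \<in> tuples mu (fun_arity L s) (univ N)" for s y
  proof -
    have "fun_int N s y = f (fun_int M s (compose (underS mu (fun_arity L s)) ?g y))"
      using is_isoD(5)[OF f s pull[OF y]] compose_inv_into_tuple[of y mu _ f "univ M"] y im by simp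
    then show ?thesis using inj is_structD(3)[OF is_isoD(1)[OF f] s pull[OF y]] by simp
  qed
  show "compose (underS mu (rel_arity L s)) ?g y \<in> rel_int M s \<longleftrightarrow> y \<in> rel_int N s"
    if s: "s \<in> rels L" and y: "y \<in> tuples mu (rel_arity L s) (univ N)" for s y
    using is_isoD(6)[OF f s pull[OF y]] compose_inv_into_tuple[of y mu _ f "univ M"] y im by simp
qed (use is_isoD[OF f] in auto)

text \<open>Every tuple over the target is the image of a tuple over \<open>univ M\<close>, so
  \<open>M\<close> and \<open>f\<close> force all interpretations. This makes \<open>f[M]\<close> a
  well-defined structure.\<close>

lemma is_iso_unique:
  assumes f: "is_iso mu L f M N" and f': "is_iso mu L f M N'"
  shows "N = N'"
proof (rule struct_eqI)
  note im = is_isoD(4)[OF f]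
  have pull: "compose (underS mu n) (inv_into (univ M) f) y \<in> tuples mu n (univ M)"
    if "y \<in> tuples mu n (univ N)" for y n
    using that im by (intro compose_in_tuples[OF that]) (auto intro: inv_into_into)
  have eq: "compose (underS mu n) f (compose (underS mu n) (inv_into (univ M) f) y) = y"
    if "y \<in> tuples mu n (univ N)" for y n
    using that im compose_inv_into_tuple by metis
  show "fun_int N s y = fun_int N' s y"
    if "s \<in> funs L" "y \<in> tuples mu (fun_arity L s) (univ N)" for s y
    using is_isoD(5)[OF f that(1) pull[OF that(2)]] is_isoD(5)[OF f' that(1) pull[OF that(2)]]
      eq[OF that(2)] by simp
  show "y \<in> rel_int N s \<longleftrightarrow> y \<in> rel_int N' s"
    if "s \<in> rels L" "y \<in> tuples mu (rel_arity L s) (univ N)" for s y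
    using is_isoD(6)[OF f that(1) pull[OF that(2)]] is_isoD(6)[OF f' that(1) pull[OF that(2)]]
      eq[OF that(2)] by simp
qed (use is_isoD[OF f] is_isoD[OF f'] in auto)

text \<open>On their universes \<open>M\<close> and \<open>N\<close> both carry the interpretations
  induced from \<open>P\<close>. This yields the substructure premise of the coherence axiom from an
  inclusion of universes.\<close>

lemma substruct_mono:
  assumes M: "substruct mu L M P" and N: "substruct mu L N P" and sub: "univ M \<subseteq> univ N"
  shows "substruct mu L M N"
proof -
  have t: "x \<in> tuples mu n (univ N)" if "x \<in> tuples mu n (univ M)" for x n
    by (rule subsetD[OF tuples_mono[OF sub] that])
  show ?thesis using assms unfolding substruct_def by (auto simp: t)
qed

text \<open>This is \<open>f[M]\<close>, an explicit term for the structure that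
  \<open>K_embedding\<close> only asserts to exist. The function interpretations are restricted
  because \<open>is_struct\<close> demands \<open>undefined\<close> off the proper tuples.\<close>

definition transport ::
  "'k rel \<Rightarrow> ('f, 'r, 'k) language \<Rightarrow> ('u \<Rightarrow> 'u) \<Rightarrow> ('f, 'r, 'k, 'u) struct \<Rightarrow>
   ('f, 'r, 'k, 'u) struct" where
  "transport mu L f M =
     \<lparr> univ = f ` univ M,
       fun_int = (\<lambda>s. if s \<in> funs L then
         (\<lambda>y \<in> tuples mu (fun_arity L s) (f ` univ M).
           f (fun_int M s (compose (underS mu (fun_arity L s)) (inv_into (univ M) f) y)))
         else (\<lambda>_. undefined)),
       rel_int = (\<lambda>s. compose (underS mu (rel_arity L s)) f ` rel_int M s) \<rparr>"

lemma is_iso_transport: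
  assumes M: "is_struct mu L (M :: ('f, 'r, 'k, 'u) struct)" and inj: "inj_on f (univ M)"
  shows "is_iso mu L f M (transport mu L f M)"
proof (rule is_isoI)
  have pull: "compose (underS mu n) (inv_into (univ M) f) y \<in> tuples mu n (univ M)"
    if "y \<in> tuples mu n (f ` univ M)" for y n
    using that by (intro compose_in_tuples[OF that]) (auto intro: inv_into_into)
  have "|f ` univ M| <o |UNIV :: 'u set|"
    using is_structD(1)[OF M] card_of_image ordLeq_ordLess_trans unfolding small_def by blast
  then show "is_struct mu L (transport mu L f M)"
    using is_structD(3)[OF M _ pull] is_structD(5,6)[OF M]
    by (auto simp: is_struct_def transport_def small_def intro!: compose_in_tuples[of _ _ _ "univ M"])
  show "fun_int (transport mu L f M) s (compose (underS mu (fun_arity L s)) f x) = f (fun_int M s x)"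
    if "s \<in> funs L" "x \<in> tuples mu (fun_arity L s) (univ M)" for s x
    using that inv_into_compose_tuple[OF that(2) inj] compose_in_tuples[OF that(2), of f "f ` univ M"]
    by (simp add: transport_def)
  show "compose (underS mu (rel_arity L s)) f x \<in> rel_int (transport mu L f M) s \<longleftrightarrow> x \<in> rel_int M s"
    if s: "s \<in> rels L" and x: "x \<in> tuples mu (rel_arity L s) (univ M)" for s x
  proof -
    \<comment> \<open>Composition with the injective \<open>f\<close> is injective on tuples, so
      taking the image of the relation adds no fact about \<open>x\<close>.\<close>
    have "x = y" if "y \<in> rel_int M s"
      "compose (underS mu (rel_arity L s)) f x = compose (underS mu (rel_arity L s)) f y" for y
      using that is_structD(5)[OF M s] inv_into_compose_tuple[OF x inj]
        inv_into_compose_tuple[of y mu _ "univ M", OF _ inj] by (metis subsetD)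
    then show ?thesis by (auto simp: transport_def)
  qed
qed (use assms in \<open>auto simp: transport_def\<close>)

section \<open>Directed posets and unions along them\<close>

lemma directed_posetD:
  assumes "directed_poset kappa I r"
  shows "\<And>i. i \<in> I \<Longrightarrow> (i, i) \<in> r" and "\<And>i j. (i, j) \<in> r \<Longrightarrow> i \<in> I \<and> j \<in> I"
    and "\<And>i j k. (i, j) \<in> r \<Longrightarrow> (j, k) \<in> r \<Longrightarrow> (i, k) \<in> r"
    and "\<And>X. X \<subseteq> I \<Longrightarrow> |X| <o kappa \<Longrightarrow> \<exists>b\<in>I. \<forall>x\<in>X. (x, b) \<in> r"
  using assms unfolding directed_poset_def partial_order_on_def preorder_on_def
  by (auto simp: refl_on_def dest: transD)

lemma finite_less_Cinfinite: "finite A \<Longrightarrow> Cinfinite r \<Longrightarrow> |A| <o r"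
  using finite_ordLess_infinite[of "|A|" r]
  by (auto simp: cinfinite_def Field_card_of card_of_well_order_on card_order_on_def)

lemma directed_poset_pair:
  assumes dir: "directed_poset kappa I r" and kappa: "Cinfinite kappa" and ij: "i \<in> I" "j \<in> I"
  shows "\<exists>k\<in>I. (i, k) \<in> r \<and> (j, k) \<in> r"
proof -
  have "|{i, j}| <o kappa"
    by (rule finite_less_Cinfinite[OF _ kappa]) simp
  then show ?thesis using directed_posetD(4)[OF dir, of "{i, j}"] ij by auto
qed

text \<open>Choosing for each element of \<open>X\<close> an index whose set contains it gives fewer
  than \<open>kappa\<close> indices, and an upper bound of these works.\<close>

lemma directed_subset_UN:
  assumes dir: "directed_poset kappa I r" and mono: "\<And>i j. (i, j) \<in> r \<Longrightarrow> A i \<subseteq> A j"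
    and X: "|X| <o kappa" "X \<subseteq> (\<Union>i\<in>I. A i)"
  shows "\<exists>i\<in>I. X \<subseteq> A i"
proof -
  obtain c where c: "\<And>x. x \<in> X \<Longrightarrow> c x \<in> I \<and> x \<in> A (c x)" using X(2) by (metis UN_E subsetD)
  have "|c ` X| <o kappa" using X(1) card_of_image ordLeq_ordLess_trans by blast
  then obtain b where "b \<in> I" "\<And>x. x \<in> X \<Longrightarrow> (c x, b) \<in> r"
    using directed_posetD(4)[OF dir, of "c ` X"] c by auto
  then show ?thesis using c mono by blast
qed

text \<open>A tuple has fewer than \<open>mu\<close> entries since \<open>n\<close> lies in
  \<open>Field mu\<close>, so its range is already contained in one stage.\<close>

lemma directed_tuples_UN:
  assumes dir: "directed_poset mu I r" and mono: "\<And>i j. (i, j) \<in> r \<Longrightarrow> A i \<subseteq> A j"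
    and mu: "Card_order mu" "n \<in> Field mu" and x: "x \<in> tuples mu n (\<Union>i\<in>I. A i)"
  shows "\<exists>i\<in>I. x \<in> tuples mu n (A i)"
proof -
  have "|x ` underS mu n| <o mu"
    using card_of_underS[OF mu] card_of_image ordLeq_ordLess_trans by blast
  then obtain i where "i \<in> I" "x ` underS mu n \<subseteq> A i"
    using directed_subset_UN[where A = A and X = "x ` underS mu n", OF dir mono] x by (auto simp: tuples_def)
  then show ?thesis using x by (auto simp: tuples_def PiE_def)
qed

text \<open>Each tuple over the union lies over a single \<open>M i\<close>, where \<open>h\<close>
  is already an isomorphism onto \<open>N i\<close>, and the stages inherit their interpretations
  from \<open>M'\<close> and \<open>N'\<close>.\<close>

lemma is_iso_UN:
  assumes L: "is_language mu L" and mu: "Card_order mu"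
    and dir: "directed_poset mu I r" and mono: "\<And>i j. (i, j) \<in> r \<Longrightarrow> univ (M i) \<subseteq> univ (M j)"
    and M: "is_struct mu L M'" "univ M' = (\<Union>i\<in>I. univ (M i))" "\<And>i. i \<in> I \<Longrightarrow> substruct mu L (M i) M'"
    and N: "is_struct mu L N'" "univ N' = (\<Union>i\<in>I. univ (N i))" "\<And>i. i \<in> I \<Longrightarrow> substruct mu L (N i) N'"
    and h: "inj_on h (univ M')" "\<And>i. i \<in> I \<Longrightarrow> is_iso mu L h (M i) (N i)"
  shows "is_iso mu L h M' N'"
proof (rule is_isoI)
  show "h ` univ M' = univ N'" using is_isoD(4)[OF h(2)] by (simp add: M(2) N(2) image_UN)
  show "fun_int N' s (compose (underS mu (fun_arity L s)) h x) = h (fun_int M' s x)"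
    if s: "s \<in> funs L" and x: "x \<in> tuples mu (fun_arity L s) (univ M')" for s x
  proof -
    have "fun_arity L s \<in> Field mu" using L s by (auto simp: is_language_def)
    then obtain i where i: "i \<in> I" and xi: "x \<in> tuples mu (fun_arity L s) (univ (M i))"
      using directed_tuples_UN[where A="\<lambda>i. univ (M i)", OF dir mono mu] x[unfolded M(2)] by blast
    have y: "compose (underS mu (fun_arity L s)) h x \<in> tuples mu (fun_arity L s) (univ (N i))"
      using compose_in_tuples[OF xi, of h] is_isoD(4)[OF h(2)[OF i]] by auto
    show ?thesis
      using is_isoD(5)[OF h(2)[OF i] s xi] M(3)[OF i] N(3)[OF i] s xi y by (auto simp: substruct_def)
  qed
  show "compose (underS mu (rel_arity L s)) h x \<in> rel_int N' s \<longleftrightarrow> x \<in> rel_int M' s"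
    if s: "s \<in> rels L" and x: "x \<in> tuples mu (rel_arity L s) (univ M')" for s x
  proof -
    have "rel_arity L s \<in> Field mu" using L s by (auto simp: is_language_def)
    then obtain i where i: "i \<in> I" and xi: "x \<in> tuples mu (rel_arity L s) (univ (M i))"
      using directed_tuples_UN[where A="\<lambda>i. univ (M i)", OF dir mono mu] x[unfolded M(2)] by blast
    have y: "compose (underS mu (rel_arity L s)) h x \<in> tuples mu (rel_arity L s) (univ (N i))"
      using compose_in_tuples[OF xi, of h] is_isoD(4)[OF h(2)[OF i]] by auto
    show ?thesis
      using is_isoD(6)[OF h(2)[OF i] s xi] M(3)[OF i] N(3)[OF i] s xi y by (auto simp: substruct_def)
  qed
qed (use M N h in auto)

section \<open>The category of a \<open>mu\<close>-AEC\<close>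

text \<open>Both elements move to a common stage \<open>k\<close>, where injectivity of
  \<open>t k\<close> identifies them; \<open>s\<close> factors through that stage as well.\<close>

lemma directed_glue_eq:
  assumes dir: "\<And>i j. i \<in> I \<Longrightarrow> j \<in> I \<Longrightarrow> \<exists>k\<in>I. (i, k) \<in> r \<and> (j, k) \<in> r"
    and inj: "\<And>i. i \<in> I \<Longrightarrow> inj_on (t i) (A i)"
    and d: "\<And>i j x. (i, j) \<in> r \<Longrightarrow> x \<in> A i \<Longrightarrow> d i j x \<in> A j"
    and t: "\<And>i j x. (i, j) \<in> r \<Longrightarrow> x \<in> A i \<Longrightarrow> t j (d i j x) = t i x"
    and s: "\<And>i j x. (i, j) \<in> r \<Longrightarrow> x \<in> A i \<Longrightarrow> s j (d i j x) = s i x"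
    and ij: "i \<in> I" "j \<in> I" "x \<in> A i" "y \<in> A j" and eq: "t i x = t j y"
  shows "s i x = s j y"
proof -
  obtain k where k: "k \<in> I" "(i, k) \<in> r" "(j, k) \<in> r" using dir ij by blast
  have "t k (d i k x) = t k (d j k y)" using t k ij eq by simp
  then have "d i k x = d j k y" using inj_onD[OF inj[OF k(1)]] d k ij by blast
  then show ?thesis using s[OF k(2) ij(3)] s[OF k(3) ij(4)] by simp
qed

text \<open>The values proposed by all representations of a point agree by
  \<open>directed_glue_eq\<close>, so an arbitrary choice among them is correct.\<close>

lemma directed_glue:
  assumes dir: "\<And>i j. i \<in> I \<Longrightarrow> j \<in> I \<Longrightarrow> \<exists>k\<in>I. (i, k) \<in> r \<and> (j, k) \<in> r"
    and inj: "\<And>i. i \<in> I \<Longrightarrow> inj_on (t i) (A i)"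
    and d: "\<And>i j x. (i, j) \<in> r \<Longrightarrow> x \<in> A i \<Longrightarrow> d i j x \<in> A j"
    and t: "\<And>i j x. (i, j) \<in> r \<Longrightarrow> x \<in> A i \<Longrightarrow> t j (d i j x) = t i x"
    and s: "\<And>i j x. (i, j) \<in> r \<Longrightarrow> x \<in> A i \<Longrightarrow> s j (d i j x) = s i x"
  obtains h where "\<And>i x. i \<in> I \<Longrightarrow> x \<in> A i \<Longrightarrow> h (t i x) = s i x"
proof
  define h where "h z = (SOME w. \<exists>i\<in>I. \<exists>x\<in>A i. z = t i x \<and> w = s i x)" for z
  show "h (t i x) = s i x" if i: "i \<in> I" and x: "x \<in> A i" for i x
  proof -
    have "\<exists>w. \<exists>j\<in>I. \<exists>y\<in>A j. t i x = t j y \<and> w = s j y" using i x by blast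
    from someI_ex[OF this] obtain j y where j: "j \<in> I" "y \<in> A j" "t i x = t j y"
      and h: "h (t i x) = s j y" unfolding h_def by blast
    have "s i x = s j y" by (rule directed_glue_eq[OF dir inj d t s i j(1) x j(2,3)])
    then show ?thesis using h by simp
  qed
qed

text \<open>
  The set-theoretic colimit of a directed system of injections is a quotient of \<open>Sigma I A\<close>; it is
  realised inside \<^typ>\<open>'u\<close> by picking representatives of the classes.
\<close>

lemma directed_quotient:
  assumes dir: "\<And>i j. i \<in> I \<Longrightarrow> j \<in> I \<Longrightarrow> \<exists>k\<in>I. (i, k) \<in> r \<and> (j, k) \<in> r"
    and r: "\<And>i. i \<in> I \<Longrightarrow> (i, i) \<in> r" "trans r" "\<And>i j. (i, j) \<in> r \<Longrightarrow> i \<in> I \<and> j \<in> I"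
    and inj: "\<And>i j. (i, j) \<in> r \<Longrightarrow> inj_on (d i j) (A i)"
    and d: "\<And>i j x. (i, j) \<in> r \<Longrightarrow> x \<in> A i \<Longrightarrow> d i j x \<in> A j"
    and d_comp: "\<And>i j k x. (i, j) \<in> r \<Longrightarrow> (j, k) \<in> r \<Longrightarrow> x \<in> A i \<Longrightarrow> d j k (d i j x) = d i k x"
    and card: "|Sigma I A| \<le>o |UNIV :: 'u set|"
  obtains t :: "'i \<Rightarrow> 'a \<Rightarrow> 'u" where "\<And>i. i \<in> I \<Longrightarrow> inj_on (t i) (A i)"
    and "\<And>i j x. (i, j) \<in> r \<Longrightarrow> x \<in> A i \<Longrightarrow> t j (d i j x) = t i x"
proof -
  obtain e :: "'i \<times> 'a \<Rightarrow> 'u" where e: "inj_on e (Sigma I A)"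
    using card card_of_ordLeq[of "Sigma I A" "UNIV :: 'u set"] by blast
  \<comment> \<open>Two pairs are identified when they become equal at a common later stage.\<close>
  define eqv where "eqv = (\<lambda>(i, x) (j, y). i \<in> I \<and> j \<in> I \<and> x \<in> A i \<and> y \<in> A j \<and>
    (\<exists>k. (i, k) \<in> r \<and> (j, k) \<in> r \<and> d i k x = d j k y))"
  have refl: "eqv (i, x) (i, x)" if "i \<in> I" "x \<in> A i" for i x
    using that r(1) by (auto simp: eqv_def)
  have sym: "eqv p q \<Longrightarrow> eqv q p" for p q
    by (cases p; cases q) (auto simp: eqv_def; metis)
  have trans: "eqv (i, x) (l, z)" if ij: "eqv (i, x) (j, y)" and jl: "eqv (j, y) (l, z)" for i x j y l z
  proof -
    obtain k k' where k: "(i, k) \<in> r" "(j, k) \<in> r" "d i k x = d j k y"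
      and k': "(j, k') \<in> r" "(l, k') \<in> r" "d j k' y = d l k' z"
      and mem: "i \<in> I" "l \<in> I" "x \<in> A i" "y \<in> A j" "z \<in> A l"
      using ij jl by (auto simp: eqv_def)
    \<comment> \<open>\<open>m\<close> lies above both witnessing stages, so both equations can be
      pushed forward to it.\<close>
    obtain m where m: "(k, m) \<in> r" "(k', m) \<in> r" using dir r(3) k(1) k'(1) by meson
    have "d i m x = d k m (d j k y)" using d_comp[OF k(1) m(1) mem(3)] k(3) by simp
    also have "\<dots> = d k' m (d j k' y)" using d_comp k(2) k'(1) m mem by simp
    also have "\<dots> = d l m z" using d_comp[OF k'(2) m(2) mem(5)] k'(3) by simp
    finally show ?thesis using mem transD[OF r(2) k(1) m(1)] transD[OF r(2) k'(2) m(2)] by (auto simp: eqv_def)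
  qed
  \<comment> \<open>The choice is made from the class as a set, so that equivalent pairs get
    literally the same representative.\<close>
  define rep where "rep p = (SOME q. q \<in> Collect (eqv p))" for p
  have rep: "eqv (i, x) (rep (i, x))" if "i \<in> I" "x \<in> A i" for i x
    using someI[of "\<lambda>q. q \<in> Collect (eqv (i, x))", of "(i, x)"] refl[OF that] by (simp add: rep_def)
  have rep_mem: "rep (i, x) \<in> Sigma I A" if "i \<in> I" "x \<in> A i" for i x
    using rep[OF that] by (cases "rep (i, x)") (auto simp: eqv_def)
  have rep_eq: "rep p = rep q" if "eqv p q" for p q
  proof -
    have "Collect (eqv p) = Collect (eqv q)" using that sym trans by (auto; metis surj_pair)
    then show ?thesis by (simp add: rep_def)
  qed
  show thesis
  proof
    show "inj_on (\<lambda>x. e (rep (i, x))) (A i)" if i: "i \<in> I" for i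
    proof (rule inj_onI)
      fix x y assume xy: "x \<in> A i" "y \<in> A i" and eq: "e (rep (i, x)) = e (rep (i, y))"
      have "rep (i, x) = rep (i, y)" using inj_onD[OF e eq] rep_mem i xy by blast
      then have "eqv (i, x) (i, y)"
        using rep[OF i xy(1)] rep[OF i xy(2)] sym trans by (metis surj_pair)
      then show "x = y" using inj xy by (auto simp: eqv_def dest: inj_onD)
    qed
    show "e (rep (j, d i j x)) = e (rep (i, x))" if ij: "(i, j) \<in> r" and x: "x \<in> A i" for i j x
    proof -
      have "eqv (j, d i j x) (i, x)"
        using ij x r(1,3) d[OF ij x] d_comp[OF ij _ x] by (auto simp: eqv_def intro!: exI[of _ j])
      then show ?thesis using rep_eq by simp
    qed
  qed
qed

text \<open>Each fibre is a copy of some \<open>A i\<close>, and regularity of the universe bounds a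
  small union of small sets.\<close>

lemma small_Sigma:
  assumes inf: "infinite (UNIV :: 'u set)" and reg: "regularCard |UNIV :: 'u set|"
    and I: "small TYPE('u) I" and A: "\<And>i. i \<in> I \<Longrightarrow> small TYPE('u) (A i)"
  shows "small TYPE('u) (Sigma I A)"
proof -
  have "|{i} \<times> A i| <o |UNIV :: 'u set|" if "i \<in> I" for i
  proof -
    have "{i} \<times> A i = Pair i ` A i" by auto
    then show ?thesis
      using A[OF that] card_of_image[of "Pair i" "A i"] ordLeq_ordLess_trans by (auto simp: small_def)
  qed
  moreover have "Sigma I A = (\<Union>i\<in>I. {i} \<times> A i)" by auto
  ultimately show ?thesis
    using card_of_UNION_ordLess_infinite_Field_regularCard[OF reg, of I "\<lambda>i. {i} \<times> A i"] inf I
    by (simp add: cinfinite_def Field_card_of card_of_card_order_on small_def)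
qed

text \<open>Lets a \<open>cardSuc lam\<close>-directed diagram be treated as
  \<open>mu\<close>-directed, the form in which the Tarski-Vaught axioms apply.\<close>

lemma directed_poset_mono:
  assumes "directed_poset kappa I r" "mu \<le>o kappa"
  shows "directed_poset mu I r"
  using assms ordLess_ordLeq_trans unfolding directed_poset_def by blast

section \<open>The axioms, K-embeddings and the category they form\<close>

locale AEC =
  fixes mu :: "'k rel" and L :: "('f, 'r, 'k) language"
    and K :: "('f, 'r, 'k, 'u) struct set"
    and le :: "('f, 'r, 'k, 'u) struct \<Rightarrow> ('f, 'r, 'k, 'u) struct \<Rightarrow> bool"
  assumes mu_AEC: "mu_AEC mu L K le"
begin

abbreviation \<C> where "\<C> \<equiv> AEC_cat mu L K le"

lemma mu: "Cinfinite mu" and abstract_class: "abstract_class mu L K le"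
  using mu_AEC unfolding mu_AEC_def by simp_all

lemma abstract_classD:
  shows L: "is_language mu L"
    and "\<forall>M\<in>K. is_struct mu L M"
    and "\<forall>M N. le M N \<longrightarrow> M \<in> K \<and> N \<in> K \<and> substruct mu L M N"
    and "\<forall>M\<in>K. le M M"
    and "\<forall>M N P. le M N \<and> le N P \<longrightarrow> le M P"
    and "\<forall>f N N'. is_iso mu L f N N' \<and> N \<in> K \<longrightarrow>
        N' \<in> K \<and> (\<forall>M. le M N \<longrightarrow> (\<exists>M'\<in>K. is_iso mu L f M M' \<and> le M' N'))"
  using abstract_class unfolding abstract_class_def by - (elim conjE, assumption)+

lemma K_struct: "M \<in> K \<Longrightarrow> is_struct mu L M"
  using abstract_classD(2) by blast

lemma leD:
  assumes "le M N"
  shows "M \<in> K" "N \<in> K" "substruct mu L M N" "univ M \<subseteq> univ N"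
proof -
  show "M \<in> K" "N \<in> K" "substruct mu L M N" using abstract_classD(3) assms by blast+
  then show "univ M \<subseteq> univ N" by (simp add: substruct_def)
qed

lemma le_refl: "M \<in> K \<Longrightarrow> le M M"
  using abstract_classD(4) by blast

lemma le_trans: "le M N \<Longrightarrow> le N P \<Longrightarrow> le M P"
  using abstract_classD(5) by blast

lemma iso_closed: "is_iso mu L f N N' \<Longrightarrow> N \<in> K \<Longrightarrow> N' \<in> K"
  using abstract_classD(6) by blast

lemma le_iso:
  assumes "is_iso mu L f N N'" "le M N"
  obtains M' where "is_iso mu L f M M'" "le M' N'"
  using abstract_classD(6)[rule_format, of f N N'] assms leD(2)[OF assms(2)] by blast

lemma coherence:
  assumes "le M P" "le N P" "univ M \<subseteq> univ N"
  shows "le M N"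
proof -
  have "\<forall>M0 M1 M2. M0 \<in> K \<and> M1 \<in> K \<and> M2 \<in> K \<and> le M0 M2 \<and> le M1 M2 \<and> substruct mu L M0 M1
        \<longrightarrow> le M0 M1"
    using mu_AEC unfolding mu_AEC_def by - (elim conjE, assumption)
  moreover have "substruct mu L M N" using substruct_mono leD(3) assms by blast
  ultimately show ?thesis using assms leD(1,2) by blast
qed

lemma Tarski_Vaught:
  assumes "small TYPE('u) (I :: 'u set)" "directed_poset mu I r"
    "\<And>i. i \<in> I \<Longrightarrow> M i \<in> K" "\<And>i j. (i, j) \<in> r \<Longrightarrow> le (M i) (M j)"
  shows "union_struct mu L I M \<in> K"
    and "j \<in> I \<Longrightarrow> le (M j) (union_struct mu L I M)"
    and "(\<And>i. i \<in> I \<Longrightarrow> le (M i) N) \<Longrightarrow> N \<in> K \<Longrightarrow> le (union_struct mu L I M) N"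
proof -
  have *: "\<forall>(I :: 'u set) r M. small TYPE('u) I \<and> directed_poset mu I r \<and> (\<forall>i\<in>I. M i \<in> K) \<and>
        (\<forall>i j. (i, j) \<in> r \<longrightarrow> le (M i) (M j)) \<longrightarrow>
          union_struct mu L I M \<in> K \<and>
          (\<forall>j\<in>I. le (M j) (union_struct mu L I M)) \<and>
          (\<forall>N\<in>K. (\<forall>i\<in>I. le (M i) N) \<longrightarrow> le (union_struct mu L I M) N)"
    using mu_AEC unfolding mu_AEC_def by - (elim conjE, assumption)
  have "union_struct mu L I M \<in> K \<and> (\<forall>j\<in>I. le (M j) (union_struct mu L I M)) \<and>
      (\<forall>N\<in>K. (\<forall>i\<in>I. le (M i) N) \<longrightarrow> le (union_struct mu L I M) N)"
    using assms by (intro *[rule_format, of I r M]) auto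
  then show "union_struct mu L I M \<in> K" "j \<in> I \<Longrightarrow> le (M j) (union_struct mu L I M)"
    "(\<And>i. i \<in> I \<Longrightarrow> le (M i) N) \<Longrightarrow> N \<in> K \<Longrightarrow> le (union_struct mu L I M) N" by blast+
qed

lemma univ_union_struct: "univ (union_struct mu L I M) = (\<Union>i\<in>I. univ (M i))"
  by (simp add: union_struct_def)

lemma \<C>_simps:
  "Obj \<C> = K" "Id \<C> M = (\<lambda>x\<in>univ M. x)" "Comp \<C> M N P g f = compose (univ M) g f"
  "f \<in> Hom \<C> M N \<longleftrightarrow> f \<in> extensional (univ M) \<and> K_embedding mu L le f M N"
  by (simp_all add: AEC_cat_def)

text \<open>By uniqueness of the target of an isomorphism, the witness \<open>M'\<close> in
  \<open>K_embedding\<close> is \<open>transport mu L f M\<close>. Membership of \<open>M\<close> in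
  \<open>K\<close> comes back from \<open>M'\<close> along the inverse isomorphism.\<close>

lemma HomD:
  assumes "f \<in> Hom \<C> M N"
  shows "M \<in> K" "N \<in> K" "inj_on f (univ M)" "f ` univ M \<subseteq> univ N" "f \<in> extensional (univ M)"
    "is_iso mu L f M (transport mu L f M)" "le (transport mu L f M) N"
    "univ (transport mu L f M) = f ` univ M"
proof -
  obtain M' where iso: "is_iso mu L f M M'" and le: "le M' N"
    using assms by (auto simp: \<C>_simps K_embedding_def)
  show M: "M \<in> K" using iso_closed[OF is_iso_inv[OF iso]] leD(1)[OF le] .
  show N: "N \<in> K" using leD(2)[OF le] .
  show inj: "inj_on f (univ M)" using is_isoD(3)[OF iso] .
  show iso': "is_iso mu L f M (transport mu L f M)"
    using is_iso_transport K_struct M inj by blast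
  then have eq: "M' = transport mu L f M" using is_iso_unique iso by blast
  then show "le (transport mu L f M) N" using le by simp
  show "f ` univ M \<subseteq> univ N" using is_isoD(4)[OF iso] leD(4)[OF le] by simp
  show "f \<in> extensional (univ M)" using assms by (simp add: \<C>_simps)
  show "univ (transport mu L f M) = f ` univ M" by (simp add: transport_def)
qed

lemma HomI:
  assumes "is_iso mu L f M M'" "le M' N"
  shows "restrict f (univ M) \<in> Hom \<C> M N"
  using assms is_iso_cong[OF assms(1), of "restrict f (univ M)"]
  by (auto simp: \<C>_simps K_embedding_def)

lemma HomI':
  assumes "is_iso mu L f M M'" "le M' N" "f \<in> extensional (univ M)"
  shows "f \<in> Hom \<C> M N"
  using HomI[OF assms(1,2)] extensional_restrict[OF assms(3)] by simp

lemma Hom_mono: "f \<in> Hom \<C> M N \<Longrightarrow> le N P \<Longrightarrow> f \<in> Hom \<C> M P"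
  using HomI'[OF HomD(6) le_trans[OF HomD(7)] HomD(5)] by blast

lemma Hom_Id: "M \<in> K \<Longrightarrow> (\<lambda>x\<in>univ M. x) \<in> Hom \<C> M M"
  using HomI[OF is_iso_id[OF K_struct] le_refl] by (simp add: id_def)

lemma Hom_compose:
  assumes f: "f \<in> Hom \<C> M N" and g: "g \<in> Hom \<C> N P"
  shows "compose (univ M) g f \<in> Hom \<C> M P"
proof -
  \<comment> \<open>Closure of \<open>le\<close> under isomorphisms moves the inclusion of
    \<open>f[M]\<close> in \<open>N\<close> along \<open>g\<close> to an inclusion in
    \<open>g[N]\<close>.\<close>
  obtain M' where M': "is_iso mu L g (transport mu L f M) M'" "le M' (transport mu L g N)"
    using le_iso[OF HomD(6)[OF g] HomD(7)[OF f]] .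
  have "restrict (g \<circ> f) (univ M) \<in> Hom \<C> M P"
    using HomI[OF is_iso_comp[OF HomD(6)[OF f] M'(1)] le_trans[OF M'(2) HomD(7)[OF g]]] .
  then show ?thesis by (simp add: compose_def comp_def)
qed

text \<open>Both images are K-submodels of \<open>P\<close>, so coherence turns the inclusion into
  \<open>le\<close> between them, and the inverse of \<open>g\<close> carries this relation back
  into \<open>N\<close>. The factor is \<open>f\<close> followed by that inverse.\<close>

lemma Hom_factor:
  assumes f: "f \<in> Hom \<C> M P" and g: "g \<in> Hom \<C> N P" and sub: "f ` univ M \<subseteq> g ` univ N"
  obtains h where "h \<in> Hom \<C> M N" "compose (univ M) g h = f"
proof
  let ?h = "restrict (inv_into (univ N) g \<circ> f) (univ M)"
  have "le (transport mu L f M) (transport mu L g N)"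
    using coherence[OF HomD(7)[OF f] HomD(7)[OF g]] sub by (simp add: HomD(8)[OF f] HomD(8)[OF g])
  then obtain M' where M': "is_iso mu L (inv_into (univ N) g) (transport mu L f M) M'" "le M' N"
    using le_iso[OF is_iso_inv[OF HomD(6)[OF g]]] by blast
  show "?h \<in> Hom \<C> M N" using HomI[OF is_iso_comp[OF HomD(6)[OF f] M'(1)] M'(2)] .
  show "compose (univ M) g ?h = f"
    using sub HomD(5)[OF f]
    by (auto simp: compose_def fun_eq_iff extensional_def subset_iff intro!: f_inv_into_f)
qed

text \<open>K-embeddings are injective, hence monomorphisms.\<close>

lemma Hom_cancel:
  assumes g: "g \<in> Hom \<C> N P" and h: "h \<in> Hom \<C> M N" "h' \<in> Hom \<C> M N"
    and eq: "\<And>x. x \<in> univ M \<Longrightarrow> g (h x) = g (h' x)"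
  shows "h = h'"
proof (rule extensionalityI[OF HomD(5)[OF h(1)] HomD(5)[OF h(2)]])
  fix x assume x: "x \<in> univ M"
  then have "h x \<in> univ N" "h' x \<in> univ N" using HomD(4)[OF h(1)] HomD(4)[OF h(2)] by auto
  then show "h x = h' x" using inj_onD[OF HomD(3)[OF g] eq[OF x]] by simp
qed

lemma is_category: "is_category \<C>"
  unfolding is_category_def
proof (intro conjI ballI)
  show "Comp \<C> W Y Z h (Comp \<C> W X Y g f) = Comp \<C> W X Z (Comp \<C> X Y Z h g) f"
    if "f \<in> Hom \<C> W X" for W X Y Z f g h
    using HomD(4)[OF that] by (auto simp: \<C>_simps(3) compose_def fun_eq_iff)
  show "Comp \<C> X X Y f (Id \<C> X) = f" "Comp \<C> X Y Y (Id \<C> Y) f = f" if "f \<in> Hom \<C> X Y" for X Y f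
    using HomD(4,5)[OF that] by (auto simp: \<C>_simps(2,3) compose_def fun_eq_iff extensional_def)
qed (auto simp: \<C>_simps(1-3) Hom_Id Hom_compose)

section \<open>Directed diagrams and their colimits\<close>

lemma diagramD:
  assumes "diagram \<C> I r D d"
  shows "\<And>i. i \<in> I \<Longrightarrow> D i \<in> K" "\<And>i j. (i, j) \<in> r \<Longrightarrow> d i j \<in> Hom \<C> (D i) (D j)"
    "\<And>i x. i \<in> I \<Longrightarrow> x \<in> univ (D i) \<Longrightarrow> d i i x = x"
    "\<And>i j k x. (i, j) \<in> r \<Longrightarrow> (j, k) \<in> r \<Longrightarrow> x \<in> univ (D i) \<Longrightarrow> d j k (d i j x) = d i k x"
    "\<And>i j x. (i, j) \<in> r \<Longrightarrow> x \<in> univ (D i) \<Longrightarrow> d i j x \<in> univ (D j)"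
proof -
  show hom: "\<And>i j. (i, j) \<in> r \<Longrightarrow> d i j \<in> Hom \<C> (D i) (D j)"
    and "\<And>i. i \<in> I \<Longrightarrow> D i \<in> K" "\<And>i x. i \<in> I \<Longrightarrow> x \<in> univ (D i) \<Longrightarrow> d i i x = x"
    using assms by (simp_all add: diagram_def \<C>_simps(1-3))
  show "\<And>i j x. (i, j) \<in> r \<Longrightarrow> x \<in> univ (D i) \<Longrightarrow> d i j x \<in> univ (D j)"
    using HomD(4)[OF hom] by blast
  show "d j k (d i j x) = d i k x" if "(i, j) \<in> r" "(j, k) \<in> r" "x \<in> univ (D i)" for i j k x
  proof -
    have "compose (univ (D i)) (d j k) (d i j) = d i k"
      using assms that by (simp add: diagram_def \<C>_simps(1-3))
    from fun_cong[OF this, of x] show ?thesis using that by (simp add: compose_def)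
  qed
qed

lemma cocone_iff:
  "cocone \<C> I r D d c t \<longleftrightarrow>
     c \<in> K \<and> (\<forall>i\<in>I. t i \<in> Hom \<C> (D i) c) \<and>
     (\<forall>i j. (i, j) \<in> r \<longrightarrow> compose (univ (D i)) (t j) (d i j) = t i)"
  by (simp add: cocone_def \<C>_simps(1-3))

lemma coconeD:
  assumes "cocone \<C> I r D d c t"
  shows "c \<in> K" "\<And>i. i \<in> I \<Longrightarrow> t i \<in> Hom \<C> (D i) c"
    "\<And>i. i \<in> I \<Longrightarrow> inj_on (t i) (univ (D i))"
    "\<And>i j x. (i, j) \<in> r \<Longrightarrow> x \<in> univ (D i) \<Longrightarrow> t j (d i j x) = t i x"
proof -
  show "t j (d i j x) = t i x" if "(i, j) \<in> r" "x \<in> univ (D i)" for i j x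
  proof -
    have "compose (univ (D i)) (t j) (d i j) = t i" using assms that by (simp add: cocone_iff)
    from fun_cong[OF this, of x] show ?thesis using that by (simp add: compose_def)
  qed
qed (use assms HomD(3) in \<open>auto simp: cocone_iff\<close>)

lemma coconeI:
  assumes dir: "directed_poset kappa I r"
    and "c \<in> K" "\<And>i. i \<in> I \<Longrightarrow> t i \<in> Hom \<C> (D i) c"
    and "\<And>i j x. (i, j) \<in> r \<Longrightarrow> x \<in> univ (D i) \<Longrightarrow> t j (d i j x) = t i x"
  shows "cocone \<C> I r D d c t"
  unfolding cocone_iff
proof (intro conjI allI impI ballI)
  show "compose (univ (D i)) (t j) (d i j) = t i" if "(i, j) \<in> r" for i j
    using HomD(5)[OF assms(3), of i] directed_posetD(2)[OF dir that] assms(4)[OF that]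
    by (auto simp: compose_def fun_eq_iff extensional_def)
qed (use assms in auto)

text \<open>\<open>t i\<close> equals \<open>t j\<close> after \<open>d i j\<close>, so the image of
  stage \<open>i\<close> is contained in that of stage \<open>j\<close>, and coherence in
  \<open>c\<close> applies. The images thus form a directed system for the Tarski-Vaught
  axioms.\<close>

lemma cocone_images_le:
  assumes dir: "directed_poset mu I r" and D: "diagram \<C> I r D d"
    and c: "cocone \<C> I r D d c t" and ij: "(i, j) \<in> r"
  shows "le (transport mu L (t i) (D i)) (transport mu L (t j) (D j))"
proof (rule coherence)
  have i: "i \<in> I" and j: "j \<in> I" using directed_posetD(2)[OF dir ij] by auto
  note ti = coconeD(2)[OF c i] and tj = coconeD(2)[OF c j]
  show "le (transport mu L (t i) (D i)) c" "le (transport mu L (t j) (D j)) c"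
    using HomD(7)[OF ti] HomD(7)[OF tj] .
  show "univ (transport mu L (t i) (D i)) \<subseteq> univ (transport mu L (t j) (D j))"
    unfolding HomD(8)[OF ti] HomD(8)[OF tj]
    using coconeD(4)[OF c ij] diagramD(5)[OF D ij] by force
qed

text \<open>The \<open>t' i\<close> glue to a map \<open>h\<close> on all of \<open>c\<close>, which
  is an isomorphism onto the union \<open>?U\<close> of their images. By the Tarski-Vaught axioms
  \<open>?U\<close> is a K-submodel of \<open>c'\<close>, so \<open>h\<close> is a
  K-embedding.\<close>

lemma colimitI:
  assumes I: "small TYPE('u) (I :: 'u set)" and dir: "directed_poset mu I r"
    and D: "diagram \<C> I r D d" and c: "cocone \<C> I r D d c t"
    and surj: "univ c = (\<Union>i\<in>I. t i ` univ (D i))"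
  shows "colimit \<C> I r D d c t"
  unfolding colimit_def
proof (intro conjI allI impI c)
  fix c' t' assume c': "cocone \<C> I r D d c' t'"
  note pair = directed_poset_pair[OF dir mu]
  obtain h0 where h0: "\<And>i x. i \<in> I \<Longrightarrow> x \<in> univ (D i) \<Longrightarrow> h0 (t i x) = t' i x"
    using directed_glue[where A = "\<lambda>i. univ (D i)" and s = t',
        OF pair coconeD(3)[OF c] diagramD(5)[OF D] coconeD(4)[OF c] coconeD(4)[OF c']] by blast
  define h where "h = restrict h0 (univ c)"
  have h: "h (t i x) = t' i x" if "i \<in> I" "x \<in> univ (D i)" for i x
    using h0[OF that] that surj by (auto simp: h_def)
  let ?M = "\<lambda>i. transport mu L (t i) (D i)" and ?N = "\<lambda>i. transport mu L (t' i) (D i)"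
  let ?U = "union_struct mu L I ?N"
  have leM: "le (?M i) c" and leN: "le (?N i) c'" and uM: "univ (?M i) = t i ` univ (D i)"
    and isoM: "is_iso mu L (t i) (D i) (?M i)" and isoN: "is_iso mu L (t' i) (D i) (?N i)"
    if "i \<in> I" for i
    using HomD[OF coconeD(2)[OF c that]] HomD[OF coconeD(2)[OF c' that]] by auto
  note TV = Tarski_Vaught[of I r ?N, OF I dir leD(1)[OF leN] cocone_images_le[OF dir D c']]
  have U: "?U \<in> K" "le ?U c'" "\<And>i. i \<in> I \<Longrightarrow> le (?N i) ?U"
    using TV leN coconeD(1)[OF c'] by blast+
  have "is_iso mu L h c ?U"
  proof (rule is_iso_UN[OF L _ dir])
    show "univ (?M i) \<subseteq> univ (?M j)" if "(i, j) \<in> r" for i j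
      using leD(4)[OF cocone_images_le[OF dir D c that]] .
    show "inj_on h (univ c)"
    proof (rule inj_onI)
      fix a b assume "a \<in> univ c" "b \<in> univ c" and eq: "h a = h b"
      then obtain i j x y where ij: "i \<in> I" "j \<in> I" "x \<in> univ (D i)" "y \<in> univ (D j)"
        and ab: "a = t i x" "b = t j y" using surj by auto
      then have eq: "t' i x = t' j y" using eq h by simp
      \<comment> \<open>The glueing argument with \<open>t\<close> and \<open>t'\<close>
        exchanged.\<close>
      show "a = b" unfolding ab
        by (rule directed_glue_eq[where A = "\<lambda>i. univ (D i)" and s = t and t = t',
              OF pair coconeD(3)[OF c'] diagramD(5)[OF D] coconeD(4)[OF c'] coconeD(4)[OF c] ij eq])
    qed
    \<comment> \<open>On the image of \<open>t i\<close> the glued map is \<open>t' i\<close> after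
      the inverse of \<open>t i\<close>.\<close>
    show "is_iso mu L h (?M i) (?N i)" if i: "i \<in> I" for i
    proof (rule is_iso_cong[OF is_iso_comp[OF is_iso_inv[OF isoM[OF i]] isoN[OF i]]])
      fix a assume "a \<in> univ (?M i)"
      then obtain x where "x \<in> univ (D i)" "a = t i x" using uM[OF i] by auto
      then show "(t' i \<circ> inv_into (univ (D i)) (t i)) a = h a"
        using h[OF i] coconeD(3)[OF c i] by simp
    qed
    show "univ c = (\<Union>i\<in>I. univ (?M i))" using surj uM by simp
    show "univ ?U = (\<Union>i\<in>I. univ (?N i))" by (rule univ_union_struct)
    show "is_struct mu L c" "is_struct mu L ?U" using K_struct U(1) coconeD(1)[OF c] by auto
  qed (use mu leD(3)[OF leM] leD(3)[OF U(3)] in auto)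
  then have hom: "h \<in> Hom \<C> c c'" by (rule HomI'[OF _ U(2)]) (simp add: h_def)
  show "\<exists>!h. h \<in> Hom \<C> c c' \<and> (\<forall>i\<in>I. Comp \<C> (D i) c c' h (t i) = t' i)"
  proof (intro ex1I[of _ h] conjI ballI hom)
    show "Comp \<C> (D i) c c' h (t i) = t' i" if "i \<in> I" for i
      using h[OF that] HomD(5)[OF coconeD(2)[OF c' that]]
      by (auto simp: \<C>_simps(3) compose_def fun_eq_iff extensional_def)
    fix g assume g: "g \<in> Hom \<C> c c' \<and> (\<forall>i\<in>I. Comp \<C> (D i) c c' g (t i) = t' i)"
    \<comment> \<open>The values at all \<open>t i x\<close> are prescribed, and by joint
      surjectivity these points exhaust \<open>c\<close>.\<close>
    show "g = h"
    proof (rule extensionalityI)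
      show "g \<in> extensional (univ c)" "h \<in> extensional (univ c)" using HomD(5) g hom by blast+
      fix a assume "a \<in> univ c"
      then obtain i x where i: "i \<in> I" and x: "x \<in> univ (D i)" and a: "a = t i x" using surj by auto
      have "compose (univ (D i)) g (t i) = t' i" using g i by (simp add: \<C>_simps(3))
      from fun_cong[OF this, of x] show "g a = h a" using h[OF i x] x a by (simp add: compose_def)
    qed
  qed
qed

text \<open>
  The union \<open>?U\<close> of the images carries a cocone itself, and the induced map \<open>c \<rightarrow> ?U \<subseteq> c\<close> can only
  be the identity.
\<close>

lemma colimit_jointly_surj:
  assumes I: "small TYPE('u) (I :: 'u set)" and dir: "directed_poset mu I r"
    and D: "diagram \<C> I r D d" and col: "colimit \<C> I r D d c t"
  shows "univ c = (\<Union>i\<in>I. t i ` univ (D i))"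
proof
  have c: "cocone \<C> I r D d c t" using col by (simp add: colimit_def)
  let ?M = "\<lambda>i. transport mu L (t i) (D i)"
  let ?U = "union_struct mu L I ?M"
  have leM: "le (?M i) c" and uM: "univ (?M i) = t i ` univ (D i)" if "i \<in> I" for i
    using HomD[OF coconeD(2)[OF c that]] by auto
  note TV = Tarski_Vaught[of I r ?M, OF I dir leD(1)[OF leM] cocone_images_le[OF dir D c]]
  have U: "?U \<in> K" "le ?U c" "\<And>i. i \<in> I \<Longrightarrow> le (?M i) ?U"
    using TV leM coconeD(1)[OF c] by blast+
  have "cocone \<C> I r D d ?U t"
  proof (rule coconeI[OF dir U(1)])
    show "t j (d i j x) = t i x" if "(i, j) \<in> r" "x \<in> univ (D i)" for i j x
      using coconeD(4)[OF c that] .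
    show "t i \<in> Hom \<C> (D i) ?U" if "i \<in> I" for i
      using HomI'[OF HomD(6) U(3)[OF that] HomD(5)] coconeD(2)[OF c that] by blast
  qed
  then obtain h where h: "h \<in> Hom \<C> c ?U" "\<And>i. i \<in> I \<Longrightarrow> Comp \<C> (D i) c ?U h (t i) = t i"
    using col unfolding colimit_def by blast
  have "\<exists>!h. h \<in> Hom \<C> c c \<and> (\<forall>i\<in>I. Comp \<C> (D i) c c h (t i) = t i)"
    using col unfolding colimit_def by blast
  moreover have "h \<in> Hom \<C> c c" "\<forall>i\<in>I. Comp \<C> (D i) c c h (t i) = t i"
    using Hom_mono[OF h(1) U(2)] h(2) by (auto simp: \<C>_simps(3))
  moreover have "Id \<C> c \<in> Hom \<C> c c" "\<forall>i\<in>I. Comp \<C> (D i) c c (Id \<C> c) (t i) = t i"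
    using is_category coconeD(1,2)[OF c] diagramD(1)[OF D]
    unfolding is_category_def \<C>_simps(1) by blast+
  ultimately have "h = Id \<C> c" by blast
  then have "univ c \<subseteq> univ ?U" using HomD(4)[OF h(1)] by (auto simp: \<C>_simps(2))
  then show "univ c \<subseteq> (\<Union>i\<in>I. t i ` univ (D i))" using uM by (auto simp: univ_union_struct)
  show "(\<Union>i\<in>I. t i ` univ (D i)) \<subseteq> univ c" using HomD(4)[OF coconeD(2)[OF c]] by blast
qed

text \<open>The injections of \<open>directed_quotient\<close> copy all stages into one set, where
  the transition maps become inclusions. The union of the copies is covered by them, so
  \<open>colimitI\<close> applies.\<close>

lemma ex_colimit:
  assumes inf: "infinite (UNIV :: 'u set)" and reg: "regularCard |UNIV :: 'u set|"
    and I: "small TYPE('u) (I :: 'u set)" and dir: "directed_poset mu I r" and D: "diagram \<C> I r D d"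
  shows "\<exists>c t. colimit \<C> I r D d c t"
proof -
  have "small TYPE('u) (Sigma I (\<lambda>i. univ (D i)))"
    by (rule small_Sigma[OF inf reg I is_structD(1)[OF K_struct[OF diagramD(1)[OF D]]]])
  then have card: "|Sigma I (\<lambda>i. univ (D i))| \<le>o |UNIV :: 'u set|"
    by (simp add: small_def ordLess_imp_ordLeq)
  have trans: "trans r" using directed_posetD(3)[OF dir] by (rule transI)
  obtain t :: "'u \<Rightarrow> 'u \<Rightarrow> 'u" where inj: "\<And>i. i \<in> I \<Longrightarrow> inj_on (t i) (univ (D i))"
    and t: "\<And>i j x. (i, j) \<in> r \<Longrightarrow> x \<in> univ (D i) \<Longrightarrow> t j (d i j x) = t i x"
    using directed_quotient[where A = "\<lambda>i. univ (D i)" and I = I and r = r and d = d,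
        OF directed_poset_pair[OF dir mu] directed_posetD(1)[OF dir] trans
        directed_posetD(2)[OF dir] HomD(3)[OF diagramD(2)[OF D]] diagramD(5)[OF D] diagramD(4)[OF D] card]
    by blast
  let ?M = "\<lambda>i. transport mu L (t i) (D i)"
  let ?U = "union_struct mu L I ?M"
  have iso: "is_iso mu L (t i) (D i) (?M i)" if "i \<in> I" for i
    using is_iso_transport[OF K_struct[OF diagramD(1)[OF D that]] inj[OF that]] .
  have M: "?M i \<in> K" if "i \<in> I" for i
    using iso_closed[OF iso[OF that] diagramD(1)[OF D that]] .
  have le: "le (?M i) (?M j)" if ij: "(i, j) \<in> r" for i j
  proof -
    have i: "i \<in> I" and j: "j \<in> I" using directed_posetD(2)[OF dir ij] by auto
    note dij = diagramD(2)[OF D ij]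
    \<comment> \<open>\<open>M'\<close> is the image of \<open>d i j\<close> transported along
      \<open>t j\<close>. As \<open>t j\<close> after \<open>d i j\<close> is \<open>t i\<close>, it
      has to be \<open>?M i\<close>.\<close>
    obtain M' where M': "is_iso mu L (t j) (transport mu L (d i j) (D i)) M'" "le M' (?M j)"
      using le_iso[OF iso[OF j] HomD(7)[OF dij]] .
    have "is_iso mu L (t i) (D i) M'"
      by (rule is_iso_cong[OF is_iso_comp[OF HomD(6)[OF dij] M'(1)]]) (simp add: t[OF ij])
    then show ?thesis using M'(2) is_iso_unique iso[OF i] by blast
  qed
  note TV = Tarski_Vaught[of I r ?M, OF I dir M le]
  have U: "?U \<in> K" "\<And>i. i \<in> I \<Longrightarrow> le (?M i) ?U" using TV by blast+
  define s where "s i = restrict (t i) (univ (D i))" for i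
  have "cocone \<C> I r D d ?U s"
  proof (rule coconeI[OF dir U(1)])
    show "s i \<in> Hom \<C> (D i) ?U" if "i \<in> I" for i
      unfolding s_def using HomI[OF iso[OF that] U(2)[OF that]] .
    show "s j (d i j x) = s i x" if "(i, j) \<in> r" "x \<in> univ (D i)" for i j x
      using that t diagramD(5)[OF D] by (simp add: s_def)
  qed
  moreover have "univ ?U = (\<Union>i\<in>I. s i ` univ (D i))"
    by (simp add: univ_union_struct s_def transport_def)
  ultimately show ?thesis using colimitI[OF I dir D] by blast
qed

section \<open>Presentability, and models as colimits of their submodels\<close>

text \<open>The maps from the hom-sets of the stages to that of the colimit are injective, as cocone
  maps are monic, and jointly surjective, as a small image fits into one stage. Over a directed
  poset this gives a colimit of sets.\<close>

lemma presentableI: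
  assumes kappa: "Cinfinite kappa" "mu \<le>o kappa" and M: "M \<in> K" "|univ M| <o kappa"
  shows "presentable TYPE('u) kappa \<C> M"
  unfolding presentable_def preserves_directed_colimits_def
proof (intro conjI allI impI; (elim conjE)?)
  show "M \<in> Obj \<C>" using M by (simp add: \<C>_simps(1))
  fix I :: "'u set" and r D d c t
  assume I: "small TYPE('u) I" and dir: "directed_poset kappa I r"
    and D: "diagram \<C> I r D d" and col: "colimit \<C> I r D d c t"
  have dir_mu: "directed_poset mu I r" using directed_poset_mono[OF dir kappa(2)] .
  note surj = colimit_jointly_surj[OF I dir_mu D col]
  have c: "cocone \<C> I r D d c t" using col by (simp add: colimit_def)
  let ?H = "\<lambda>i. Hom \<C> M (D i)"
  define d' where "d' i j f = compose (univ M) (d i j) f" for i j f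
  define t' where "t' i f = compose (univ M) (t i) f" for i f
  note pair = directed_poset_pair[OF dir kappa(1)]
  have d'_hom: "d' i j f \<in> ?H j" if "(i, j) \<in> r" "f \<in> ?H i" for i j f
    unfolding d'_def using Hom_compose[OF that(2) diagramD(2)[OF D that(1)]] .
  have t'_hom: "t' i f \<in> Hom \<C> M c" if "i \<in> I" "f \<in> ?H i" for i f
    unfolding t'_def using Hom_compose[OF that(2) coconeD(2)[OF c that(1)]] .
  have t'_d': "t' j (d' i j f) = t' i f" if "(i, j) \<in> r" "f \<in> ?H i" for i j f
    using coconeD(4)[OF c that(1)] HomD(4)[OF that(2)]
    by (auto simp: t'_def d'_def compose_def fun_eq_iff)
  have t'_inj: "inj_on (t' i) (?H i)" if i: "i \<in> I" for i
  proof (rule inj_onI)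
    fix f g assume fg: "f \<in> ?H i" "g \<in> ?H i" and eq: "t' i f = t' i g"
    show "f = g"
    proof (rule Hom_cancel[OF coconeD(2)[OF c i] fg])
      show "t i (f x) = t i (g x)" if "x \<in> univ M" for x
        using fun_cong[OF eq, of x] that by (simp add: t'_def compose_def)
    qed
  qed
  \<comment> \<open>The image of \<open>M\<close> has fewer than \<open>kappa\<close> elements, so
    it lies in the image of one stage; \<open>Hom_factor\<close> then provides a K-embedding into
    that stage.\<close>
  have lift: "\<exists>i\<in>I. \<exists>g\<in>?H i. f = t' i g" if f: "f \<in> Hom \<C> M c" for f
  proof -
    have "|f ` univ M| <o kappa" using M(2) card_of_image ordLeq_ordLess_trans by blast
    moreover have "t i ` univ (D i) \<subseteq> t j ` univ (D j)" if "(i, j) \<in> r" for i j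
      using coconeD(4)[OF c that] diagramD(5)[OF D that] by force
    moreover have "f ` univ M \<subseteq> (\<Union>i\<in>I. t i ` univ (D i))" using HomD(4)[OF f] surj by simp
    ultimately obtain i where i: "i \<in> I" "f ` univ M \<subseteq> t i ` univ (D i)"
      using directed_subset_UN[OF dir, of "\<lambda>i. t i ` univ (D i)" "f ` univ M"] by blast
    then show ?thesis using Hom_factor[OF f coconeD(2)[OF c i(1)] i(2)] unfolding t'_def by metis
  qed
  show "colimit Set_cat I r (\<lambda>i. on_obj (hom_functor \<C> M) (D i))
      (\<lambda>i j. on_hom (hom_functor \<C> M) (D i) (D j) (d i j))
      (on_obj (hom_functor \<C> M) c) (\<lambda>i. on_hom (hom_functor \<C> M) (D i) c (t i))"
    unfolding colimit_def hom_functor_def functor_data.simps \<C>_simps(3) d'_def[symmetric] t'_def[symmetric]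
  proof (intro conjI allI impI)
    show "cocone Set_cat I r ?H (\<lambda>i j. restrict (d' i j) (?H i)) (Hom \<C> M c) (\<lambda>i. restrict (t' i) (?H i))"
      using t'_hom t'_d' d'_hom directed_posetD(2)[OF dir]
      by (auto simp: cocone_def Set_cat_def compose_def fun_eq_iff)
    fix X s
    assume "cocone Set_cat I r ?H (\<lambda>i j. restrict (d' i j) (?H i)) X s"
    then have s: "\<And>i. i \<in> I \<Longrightarrow> s i \<in> ?H i \<rightarrow>\<^sub>E X"
      and s': "\<And>i j. (i, j) \<in> r \<Longrightarrow> compose (?H i) (s j) (restrict (d' i j) (?H i)) = s i"
      by (auto simp: cocone_def Set_cat_def)
    have s_d': "s j (d' i j f) = s i f" if "(i, j) \<in> r" "f \<in> ?H i" for i j f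
      using fun_cong[OF s'[OF that(1)], of f] that by (simp add: compose_def)
    \<comment> \<open>The glueing argument with hom-sets in place of universes.\<close>
    obtain h where h: "\<And>i f. i \<in> I \<Longrightarrow> f \<in> ?H i \<Longrightarrow> h (t' i f) = s i f"
      using directed_glue[where A = ?H and t = t' and s = s and d = d' and r = r, OF pair t'_inj d'_hom t'_d' s_d'] by blast
    show "\<exists>!h. h \<in> Hom Set_cat (Hom \<C> M c) X \<and>
        (\<forall>i\<in>I. Comp Set_cat (?H i) (Hom \<C> M c) X h (restrict (t' i) (?H i)) = s i)"
    proof (intro ex1I[of _ "restrict h (Hom \<C> M c)"] conjI ballI)
      show "restrict h (Hom \<C> M c) \<in> Hom Set_cat (Hom \<C> M c) X"
        using lift h s by (fastforce simp: Set_cat_def)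
      show "Comp Set_cat (?H i) (Hom \<C> M c) X (restrict h (Hom \<C> M c)) (restrict (t' i) (?H i)) = s i"
        if "i \<in> I" for i
        using h[OF that] t'_hom[OF that] s[OF that]
        by (auto simp: Set_cat_def compose_def fun_eq_iff PiE_def extensional_def)
      fix g assume g: "g \<in> Hom Set_cat (Hom \<C> M c) X \<and>
        (\<forall>i\<in>I. Comp Set_cat (?H i) (Hom \<C> M c) X g (restrict (t' i) (?H i)) = s i)"
      show "g = restrict h (Hom \<C> M c)"
      proof (rule extensionalityI)
        show "g \<in> extensional (Hom \<C> M c)" using g by (auto simp: Set_cat_def PiE_def)
        fix f assume f: "f \<in> Hom \<C> M c"
        then obtain i f' where i: "i \<in> I" "f' \<in> ?H i" "f = t' i f'" using lift by blast
        have "compose (?H i) g (restrict (t' i) (?H i)) = s i" using g i by (simp add: Set_cat_def)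
        from fun_cong[OF this, of f'] show "g f = restrict h (Hom \<C> M c) f"
          using f i h by (simp add: compose_def)
      qed simp
    qed
  qed
qed

text \<open>With \<open>I\<close> ordered by inclusion of images, \<open>Hom_factor\<close> yields
  the transition maps and \<open>Hom_cancel\<close> their functoriality; covering \<open>X\<close>
  makes the cocone a colimit by \<open>colimitI\<close>.\<close>

lemma colimit_of_subobjects:
  fixes I :: "'u set" and D :: "'u \<Rightarrow> ('f, 'r, 'k, 'u) struct"
  assumes kappa: "mu \<le>o kappa" and I: "small TYPE('u) I" and X: "X \<in> K"
    and t: "\<And>i. i \<in> I \<Longrightarrow> t i \<in> Hom \<C> (D i) X"
    and inj: "inj_on (\<lambda>i. t i ` univ (D i)) I"
    and dir: "\<And>Y. Y \<subseteq> I \<Longrightarrow> |Y| <o kappa \<Longrightarrow> \<exists>b\<in>I. \<forall>y\<in>Y. t y ` univ (D y) \<subseteq> t b ` univ (D b)"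
    and cover: "univ X \<subseteq> (\<Union>i\<in>I. t i ` univ (D i))"
  shows "\<exists>r d. directed_poset kappa I r \<and> diagram \<C> I r D d \<and> colimit \<C> I r D d X t"
proof -
  define r where "r = {(i, j). i \<in> I \<and> j \<in> I \<and> t i ` univ (D i) \<subseteq> t j ` univ (D j)}"
  have "trans r" unfolding r_def by (rule transI) blast
  \<comment> \<open>Here distinct indices must have distinct images.\<close>
  moreover have "antisym r" using inj_onD[OF inj] unfolding r_def by (intro antisymI) blast
  moreover have "r \<subseteq> I \<times> I" "refl_on I r" by (auto simp: r_def refl_on_def)
  ultimately have "partial_order_on I r" by (simp add: partial_order_on_def preorder_on_def)
  moreover have "\<exists>b\<in>I. \<forall>y\<in>Y. (y, b) \<in> r" if Y: "Y \<subseteq> I" "|Y| <o kappa" for Y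
  proof -
    obtain b where b: "b \<in> I" "\<And>y. y \<in> Y \<Longrightarrow> t y ` univ (D y) \<subseteq> t b ` univ (D b)"
      using dir[OF Y] by blast
    then have "(y, b) \<in> r" if "y \<in> Y" for y using that Y(1) by (simp add: r_def subset_iff)
    then show ?thesis using b(1) by blast
  qed
  ultimately have dir_r: "directed_poset kappa I r" by (simp add: directed_poset_def)
  \<comment> \<open>Any factor may be chosen: cancelling \<open>t j\<close> makes it unique.\<close>
  define d where "d i j = (SOME h. h \<in> Hom \<C> (D i) (D j) \<and> compose (univ (D i)) (t j) h = t i)" for i j
  have d: "d i j \<in> Hom \<C> (D i) (D j)" "compose (univ (D i)) (t j) (d i j) = t i" if "(i, j) \<in> r" for i j
  proof -
    have "\<exists>h. h \<in> Hom \<C> (D i) (D j) \<and> compose (univ (D i)) (t j) h = t i"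
    proof -
      have ij: "i \<in> I" "j \<in> I" "t i ` univ (D i) \<subseteq> t j ` univ (D j)" using that by (simp_all add: r_def)
      show ?thesis using Hom_factor[OF t[OF ij(1)] t[OF ij(2)] ij(3)] by metis
    qed
    from someI_ex[OF this] show "d i j \<in> Hom \<C> (D i) (D j)" "compose (univ (D i)) (t j) (d i j) = t i"
      unfolding d_def by blast+
  qed
  have d_app: "t j (d i j x) = t i x" if "(i, j) \<in> r" "x \<in> univ (D i)" for i j x
    using fun_cong[OF d(2)[OF that(1)], of x] that by (simp add: compose_def)
  note rI = directed_posetD(2)[OF dir_r]
  have D: "diagram \<C> I r D d"
    unfolding diagram_def \<C>_simps(1-3)
  proof (intro conjI ballI allI impI; (elim conjE)?)
    show "D i \<in> K" if "i \<in> I" for i using HomD(1)[OF t[OF that]] .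
    show "d i j \<in> Hom \<C> (D i) (D j)" if "(i, j) \<in> r" for i j using d(1)[OF that] .
    show "d i i = (\<lambda>x\<in>univ (D i). x)" if i: "i \<in> I" for i
      using directed_posetD(1)[OF dir_r i]
      by (intro Hom_cancel[OF t[OF i] d(1) Hom_Id[OF HomD(1)[OF t[OF i]]]]) (auto simp: d_app)
    show "compose (univ (D i)) (d j k) (d i j) = d i k" if ij: "(i, j) \<in> r" and jk: "(j, k) \<in> r" for i j k
    proof (rule Hom_cancel[OF t Hom_compose[OF d(1)[OF ij] d(1)[OF jk]] d(1)])
      show ik: "(i, k) \<in> r" using directed_posetD(3)[OF dir_r ij jk] .
      show "k \<in> I" using rI[OF jk] by simp
      show "t k (compose (univ (D i)) (d j k) (d i j) x) = t k (d i k x)" if "x \<in> univ (D i)" for x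
        using d_app[OF ij that] d_app[OF ik that] d_app[OF jk, of "d i j x"] HomD(4)[OF d(1)[OF ij]] that
        by (auto simp: compose_def)
    qed
  qed
  have "cocone \<C> I r D d X t" by (rule coconeI[OF dir_r X t d_app])
  moreover have "univ X = (\<Union>i\<in>I. t i ` univ (D i))" using cover HomD(4)[OF t] by blast
  ultimately have "colimit \<C> I r D d X t"
    using colimitI[OF I directed_poset_mono[OF dir_r kappa] D] by blast
  then show ?thesis using dir_r D by blast
qed

end

section \<open>Cardinalities\<close>

text \<open>An injection of \<open>A\<close> into \<open>B\<close>, applied entrywise, maps
  sequences injectively and keeps their length.\<close>

lemma card_seqs_mono:
  assumes "|A| \<le>o |B|"
  shows "|seqs mu A| \<le>o |seqs mu B|"
proof -
  obtain f where f: "inj_on f A" "f ` A \<subseteq> B" using assms card_of_ordLeq[of A B] by blast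
  let ?F = "\<lambda>(n, x). (n, compose (underS mu n) f x)"
  have "inj_on ?F (seqs mu A)"
  proof (rule inj_onI)
    fix p q assume pq: "p \<in> seqs mu A" "q \<in> seqs mu A" and eq: "?F p = ?F q"
    obtain n x y where nxy: "p = (n, x)" "q = (n, y)"
      and c: "compose (underS mu n) f x = compose (underS mu n) f y"
      using eq by (cases p; cases q) auto
    have "x \<in> tuples mu n A" "y \<in> tuples mu n A" using pq nxy by (auto simp: seqs_def)
    then show "p = q" using inv_into_compose_tuple[OF _ f(1)] c nxy by metis
  qed
  moreover have "?F ` seqs mu A \<subseteq> seqs mu B"
    using f(2) by (auto simp: seqs_def intro: compose_in_tuples)
  ultimately show ?thesis using card_of_ordLeq by blast
qed

lemma card_leq_Field_iff: "Card_order r \<Longrightarrow> |A| \<le>o r \<longleftrightarrow> |A| \<le>o |Field r|"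
  using card_of_Field_ordIso[of r] ordLeq_ordIso_trans ordIso_symmetric by blast

text \<open>\<open>closed_universe\<close> speaks of function sets only, so subsets of
  \<open>X\<close> are coded by two-valued functions on \<open>Field lam\<close>, by way of an
  injection of \<open>X\<close> into it.\<close>

lemma small_Pow:
  assumes U: "closed_universe TYPE('u) lam" and lam: "Card_order lam" and X: "|X| \<le>o lam"
  shows "small TYPE('u) (Pow X)"
proof -
  have inf: "infinite (UNIV :: 'u set)" using U by (simp add: closed_universe_def)
  obtain a b :: 'u where ab: "a \<noteq> b"
    using inf by (metis (full_types) UNIV_I ex_new_if_finite finite.intros(1) finite_insert insertCI)
  have "|{a, b}| <o |UNIV :: 'u set|"
    using inf by (intro finite_less_Cinfinite) (auto simp: cinfinite_def Field_card_of card_of_card_order_on)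
  then have small: "small TYPE('u) (Field lam \<rightarrow>\<^sub>E {a, b})"
    using U by (simp add: closed_universe_def small_def)
  obtain h where h: "inj_on h X" "h ` X \<subseteq> Field lam"
    using X card_of_ordLeq[of X "Field lam"] unfolding card_leq_Field_iff[OF lam] by metis
  let ?F = "\<lambda>S. \<lambda>z\<in>Field lam. if z \<in> h ` S then a else b"
  have "inj_on ?F (Pow X)"
  proof (rule inj_onI)
    fix S T assume ST: "S \<in> Pow X" "T \<in> Pow X" and eq: "?F S = ?F T"
    have "h z \<in> h ` S \<longleftrightarrow> h z \<in> h ` T" if "z \<in> X" for z
      using fun_cong[OF eq, of "h z"] ab h(2) that by (auto split: if_splits)
    then show "S = T" using ST h(1) by (auto simp: inj_on_image_mem_iff)
  qed
  moreover have "?F ` Pow X \<subseteq> Field lam \<rightarrow>\<^sub>E {a, b}" by auto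
  ultimately have "|Pow X| \<le>o |Field lam \<rightarrow>\<^sub>E {a, b}|" using card_of_ordLeq by blast
  then show ?thesis using small ordLeq_ordLess_trans unfolding small_def by blast
qed

lemma small_image: "small U A \<Longrightarrow> small U (f ` A)"
  using card_of_image ordLeq_ordLess_trans unfolding small_def by blast

lemma small_subset: "small U B \<Longrightarrow> A \<subseteq> B \<Longrightarrow> small U A"
  using card_of_mono1 ordLeq_ordLess_trans unfolding small_def by blast

text \<open>A nonempty subset of size at most \<open>lam\<close> is the range of a function from
  \<open>Field lam\<close> into \<open>X\<close>, and there is only a small set of these functions.
  The empty set is added separately because it need not be such a range.\<close>

lemma small_bounded_subsets:
  assumes U: "closed_universe TYPE('u) lam" and lam: "Card_order lam"
    and X: "small TYPE('u) (X :: 'u set)"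
  shows "small TYPE('u) {B. B \<subseteq> X \<and> |B| \<le>o lam}"
proof -
  have inf: "infinite (UNIV :: 'u set)" using U by (simp add: closed_universe_def)
  let ?G = "(\<lambda>f. f ` Field lam) ` (Field lam \<rightarrow>\<^sub>E X)"
  have "small TYPE('u) ?G" using U X by (intro small_image) (auto simp: closed_universe_def)
  moreover have "|{{} :: 'u set}| <o |UNIV :: 'u set|"
    using inf by (intro finite_less_Cinfinite) (auto simp: cinfinite_def Field_card_of card_of_card_order_on)
  ultimately have "small TYPE('u) ({{}} \<union> ?G)"
    using card_of_Un_ordLess_infinite[OF inf] unfolding small_def by blast
  moreover have "{B. B \<subseteq> X \<and> |B| \<le>o lam} \<subseteq> {{}} \<union> ?G"
  proof
    fix B assume "B \<in> {B. B \<subseteq> X \<and> |B| \<le>o lam}"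
    then have B: "B \<subseteq> X" "|B| \<le>o |Field lam|" using card_leq_Field_iff[OF lam] by auto
    show "B \<in> {{}} \<union> ?G"
    proof (cases "B = {}")
      case False
      then obtain g where g: "g ` Field lam = B"
        using B(2) card_of_ordLeq2[of B "Field lam"] by metis
      then have "restrict g (Field lam) \<in> Field lam \<rightarrow>\<^sub>E X" using B(1) by auto
      moreover have "restrict g (Field lam) ` Field lam = B" using g by simp
      ultimately show ?thesis by (intro UnI2) (rule image_eqI, rule sym)
    qed simp
  qed
  ultimately show ?thesis by (rule small_subset)
qed

section \<open>Models of size at most \<open>lam\<close> and accessibility\<close>

locale AEC_LS = AEC mu L K le
  for mu :: "'k rel" and L :: "('f, 'r, 'k) language"
    and K :: "('f, 'r, 'k, 'u) struct set"
    and le :: "('f, 'r, 'k, 'u) struct \<Rightarrow> ('f, 'r, 'k, 'u) struct \<Rightarrow> bool" +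
  fixes lam :: "'u rel"
  assumes closed_universe: "closed_universe TYPE('u) lam" and LST: "LST_cardinal mu L K le lam"
begin

lemma Card_order_lam: "Card_order lam" and lam_less: "lam <o |UNIV :: 'u set|"
  and seqs_lam: "|seqs mu (Field lam)| =o lam" and language_le: "( |funs L| +c |rels L| ) +c mu \<le>o lam"
  using LST by (simp_all add: LST_cardinal_def)

lemma mu_le_lam: "mu \<le>o lam"
  using ordLeq_transitive[OF ordLeq_csum2 language_le] mu by blast

lemma funs_le_lam: "|funs L| \<le>o lam" and rels_le_lam: "|rels L| \<le>o lam"
proof -
  have "|funs L| +c |rels L| \<le>o lam"
    using ordLeq_transitive[OF ordLeq_csum1[OF Card_order_csum] language_le] .
  then show "|funs L| \<le>o lam" "|rels L| \<le>o lam"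
    using ordLeq_transitive[OF ordLeq_csum1[OF card_of_Card_order]]
      ordLeq_transitive[OF ordLeq_csum2[OF card_of_Card_order]] by blast+
qed

lemma Cinfinite_lam: "Cinfinite lam"
  using Card_order_lam cinfinite_mono[OF mu_le_lam] mu by blast

lemmas le_lam_iff = card_leq_Field_iff[OF Card_order_lam]

text \<open>This is where \<open>lam = lam^{<mu}\<close> enters.\<close>

lemma card_seqs_le_lam:
  assumes "|A| \<le>o lam"
  shows "|seqs mu A| \<le>o lam"
proof -
  have "|seqs mu A| \<le>o |seqs mu (Field lam)|" using card_seqs_mono assms le_lam_iff by blast
  then show ?thesis using seqs_lam ordLeq_ordIso_trans by blast
qed

text \<open>For \<open>A\<close> of size at most \<open>lam\<close> the bound
  \<open>|seqs mu A| +c lam\<close> collapses to \<open>lam\<close>.\<close>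

lemma Lowenheim_Skolem:
  assumes "M \<in> K" "A \<subseteq> univ M" "|A| \<le>o lam"
  obtains N where "le N M" "A \<subseteq> univ N" "|univ N| \<le>o lam"
proof -
  obtain N where N: "le N M" "A \<subseteq> univ N" "|univ N| \<le>o |seqs mu A| +c lam"
    using LST assms unfolding LST_cardinal_def by blast
  have "|seqs mu A| +c lam =o lam"
    using csum_absorb2[OF Cinfinite_lam card_seqs_le_lam[OF assms(3)]] .
  then show thesis using that N ordLeq_ordIso_trans by blast
qed

lemma less_cardSuc_lam: "|A| <o cardSuc lam \<longleftrightarrow> |A| \<le>o lam"
  using cardSuc_ordLeq_ordLess[OF Card_order_lam card_of_Card_order] .

text \<open>By Cantor's theorem the successor of \<open>lam\<close> is at most \<open>2^lam\<close>,
  which is small by closure of the universe under powers.\<close>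

lemma cardSuc_lam_less: "cardSuc lam <o |UNIV :: 'u set|"
proof -
  have "lam =o |Field lam|" using card_of_Field_ordIso[OF Card_order_lam] ordIso_symmetric by blast
  then have "lam <o |Pow (Field lam)|" using card_of_Pow ordIso_ordLess_trans by blast
  then have "cardSuc lam \<le>o |Pow (Field lam)|"
    using cardSuc_least[OF Card_order_lam card_of_Card_order] by blast
  moreover have "|Pow (Field lam)| <o |UNIV :: 'u set|"
    using small_Pow[OF closed_universe Card_order_lam, of "Field lam"]
      card_of_Field_ordIso[OF Card_order_lam] ordIso_imp_ordLeq unfolding small_def by blast
  ultimately show ?thesis using ordLeq_ordLess_trans by blast
qed

lemma mu_le_cardSuc_lam: "mu \<le>o cardSuc lam"
  using ordLeq_transitive[OF mu_le_lam] cardSuc_ordLeq[OF Card_order_lam] by blast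

text \<open>Only \<open>lam\<close> many atomic facts can be stated over \<open>Field lam\<close>,
  hence at most \<open>2^lam\<close> structures arise.\<close>

lemma small_structs: "small TYPE('u) {M \<in> K. univ M \<subseteq> Field lam}"
proof -
  let ?S = "seqs mu (Field lam)"
  \<comment> \<open>The possible atomic facts: membership, function values and relations. Each tuple
    is paired with its arity so as to be an element of \<open>?S\<close>, which has size
    \<open>lam\<close>.\<close>
  let ?X = "Field lam <+> (funs L \<times> (?S \<times> Field lam)) <+> (rels L \<times> ?S)"
  have inf: "infinite (Field lam)" using Cinfinite_lam by (simp add: cinfinite_def)
  have F: "|Field lam| \<le>o lam" using card_of_Field_ordIso[OF Card_order_lam] ordIso_imp_ordLeq by blast
  have "|?X| \<le>o lam"
    by (intro card_of_Plus_ordLeq_infinite_Field card_of_Times_ordLeq_infinite_Field inf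
        Card_order_lam F funs_le_lam rels_le_lam ordIso_imp_ordLeq[OF seqs_lam])
  then have small: "small TYPE('u) (Pow ?X)" by (rule small_Pow[OF closed_universe Card_order_lam])
  txt \<open>A structure is determined by the set of its atomic facts.\<close>
  define code where "code M = {z. case z of Inl u \<Rightarrow> u \<in> univ M
      | Inr (Inl (s, (n, x), y)) \<Rightarrow>
          s \<in> funs L \<and> n = fun_arity L s \<and> x \<in> tuples mu n (univ M) \<and> y = fun_int M s x
      | Inr (Inr (s, n, x)) \<Rightarrow> s \<in> rels L \<and> n = rel_arity L s \<and> x \<in> rel_int M s}"
    for M :: "('f, 'r, 'k, 'u) struct"
  have "inj_on code {M \<in> K. univ M \<subseteq> Field lam}"
  proof (rule inj_onI)
    fix M N assume "M \<in> {M \<in> K. univ M \<subseteq> Field lam}" "N \<in> {M \<in> K. univ M \<subseteq> Field lam}"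
      and code: "code M = code N"
    then have MN: "is_struct mu L M" "is_struct mu L N" using K_struct by auto
    have eq: "z \<in> code M \<longleftrightarrow> z \<in> code N" for z using code by simp
    \<comment> \<open>The universes come first, since the tuples to compare are formed over
      them.\<close>
    have u: "univ M = univ N" using eq[of "Inl _"] by (auto simp: code_def)
    show "M = N"
    proof (rule struct_eqI[OF MN u])
      show "fun_int M s x = fun_int N s x"
        if "s \<in> funs L" "x \<in> tuples mu (fun_arity L s) (univ M)" for s x
        using eq[of "Inr (Inl (s, (fun_arity L s, x), fun_int M s x))"] that by (simp add: code_def)
      show "x \<in> rel_int M s \<longleftrightarrow> x \<in> rel_int N s" if "s \<in> rels L" for s x
        using eq[of "Inr (Inr (s, rel_arity L s, x))"] that by (simp add: code_def)
    qed
  qed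
  moreover have "code M \<subseteq> ?X" if M: "M \<in> K" "univ M \<subseteq> Field lam" for M
  proof -
    note st = K_struct[OF M(1)]
    have seq: "(n, x) \<in> ?S" if "n \<in> Field mu" "x \<in> tuples mu n (univ M)" for n x
      using that tuples_mono[OF M(2), of mu n] by (auto simp: seqs_def)
    show ?thesis
      using M(2) is_structD(3)[OF st] is_structD(5)[OF st] seq L
      by (fastforce simp: code_def is_language_def split: sum.splits)
  qed
  ultimately have "|{M \<in> K. univ M \<subseteq> Field lam}| \<le>o |Pow ?X|"
    using card_of_ordLeq[of "{M \<in> K. univ M \<subseteq> Field lam}" "Pow ?X"] by blast
  then show ?thesis using small ordLeq_ordLess_trans unfolding small_def by blast
qed

text \<open>Copies a submodel onto a subset of \<open>Field lam\<close>, so that a small set of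
  objects represents all submodels of this size; \<open>t\<close> is the inverse of the copying
  map.\<close>

lemma small_copy:
  assumes N: "le N X" "|univ N| \<le>o lam"
  obtains D t where "D \<in> K" "univ D \<subseteq> Field lam" "t \<in> Hom \<C> D X" "t ` univ D = univ N"
proof -
  obtain g where g: "inj_on g (univ N)" "g ` univ N \<subseteq> Field lam"
    using N(2) card_of_ordLeq[of "univ N" "Field lam"] le_lam_iff by blast
  let ?D = "transport mu L g N"
  have iso: "is_iso mu L g N ?D" using is_iso_transport[OF K_struct[OF leD(1)[OF N(1)]] g(1)] .
  show thesis
  proof (rule that)
    show "?D \<in> K" using iso_closed[OF iso leD(1)[OF N(1)]] .
    show "univ ?D \<subseteq> Field lam" using is_isoD(4)[OF iso] g(2) by simp
    show "restrict (inv_into (univ N) g) (univ ?D) \<in> Hom \<C> ?D X"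
      using HomI[OF is_iso_inv[OF iso] N(1)] .
    show "restrict (inv_into (univ N) g) (univ ?D) ` univ ?D = univ N"
      using is_isoD(4)[OF is_iso_inv[OF iso]] by simp
  qed
qed

lemma colimit_of_small:
  assumes X: "X \<in> K"
  shows "\<exists>(I :: 'u set) r D d t. small TYPE('u) I \<and> directed_poset (cardSuc lam) I r \<and>
    diagram \<C> I r D d \<and> (\<forall>i\<in>I. D i \<in> K \<and> univ (D i) \<subseteq> Field lam) \<and> colimit \<C> I r D d X t"
proof -
  \<comment> \<open>Universes are collected instead of submodels, so that different indices later
    have different images.\<close>
  define S where "S = {univ N |N. le N X \<and> |univ N| \<le>o lam}"
  have "S \<subseteq> {B. B \<subseteq> univ X \<and> |B| \<le>o lam}" using leD(4) by (auto simp: S_def)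
  then have small: "small TYPE('u) S"
    using small_subset small_bounded_subsets[OF closed_universe Card_order_lam is_structD(1)[OF K_struct[OF X]]]
    by blast
  \<comment> \<open>Index posets have to live on the type of the universe, so the members of
    \<open>S\<close> are encoded by its elements.\<close>
  then obtain enc :: "'u set \<Rightarrow> 'u" where enc: "inj_on enc S"
    using card_of_ordLeq[of S "UNIV :: 'u set"] ordLess_imp_ordLeq unfolding small_def by blast
  define I where "I = enc ` S"
  define dec where "dec = inv_into S enc"
  have dec: "dec i \<in> S" if "i \<in> I" for i
    using that unfolding dec_def I_def by (rule inv_into_into)
  have dec_enc: "enc B \<in> I" "dec (enc B) = B" if "B \<in> S" for B
    using that enc by (auto simp: I_def dec_def)
  have "\<exists>D t. D \<in> K \<and> univ D \<subseteq> Field lam \<and> t \<in> Hom \<C> D X \<and> t ` univ D = B" if B: "B \<in> S" for B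
  proof -
    obtain N where N: "le N X" "|univ N| \<le>o lam" "B = univ N" using B by (auto simp: S_def)
    show ?thesis unfolding N(3) by (rule small_copy[OF N(1,2)]) (intro exI conjI)
  qed
  then have "\<forall>i\<in>I. \<exists>D t. D \<in> K \<and> univ D \<subseteq> Field lam \<and> t \<in> Hom \<C> D X \<and> t ` univ D = dec i"
    using dec by simp
  from bchoice[OF this] obtain D where "\<forall>i\<in>I. \<exists>t. D i \<in> K \<and> univ (D i) \<subseteq> Field lam \<and>
      t \<in> Hom \<C> (D i) X \<and> t ` univ (D i) = dec i" ..
  from bchoice[OF this] obtain t where Dt: "\<forall>i\<in>I. D i \<in> K \<and> univ (D i) \<subseteq> Field lam \<and>
      t i \<in> Hom \<C> (D i) X \<and> t i ` univ (D i) = dec i" ..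
  have im: "t i ` univ (D i) = dec i" if "i \<in> I" for i using Dt that by blast
  have small_I: "small TYPE('u) I" unfolding I_def using small_image[OF small] .
  have "\<exists>r d. directed_poset (cardSuc lam) I r \<and> diagram \<C> I r D d \<and> colimit \<C> I r D d X t"
  proof (rule colimit_of_subobjects[OF mu_le_cardSuc_lam small_I X])
    show "t i \<in> Hom \<C> (D i) X" if "i \<in> I" for i using Dt that by blast
    have "inj_on dec I" unfolding dec_def I_def by (rule inj_on_inv_into) simp
    then show "inj_on (\<lambda>i. t i ` univ (D i)) I" by (simp add: inj_on_def im)
    show "univ X \<subseteq> (\<Union>i\<in>I. t i ` univ (D i))"
    proof
      fix x assume x: "x \<in> univ X"
      \<comment> \<open>Loewenheim-Skolem for a singleton puts every point into a submodel of size
        at most \<open>lam\<close>.\<close>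
      have "|{x}| \<le>o lam"
        by (rule ordLess_imp_ordLeq[OF finite_less_Cinfinite[OF _ Cinfinite_lam]]) simp
      moreover have "{x} \<subseteq> univ X" using x by simp
      ultimately obtain N where "le N X" "{x} \<subseteq> univ N" "|univ N| \<le>o lam"
        using Lowenheim_Skolem[OF X] by metis
      then have "univ N \<in> S" "x \<in> univ N" by (auto simp: S_def)
      then show "x \<in> (\<Union>i\<in>I. t i ` univ (D i))" using dec_enc[of "univ N"] im by auto
    qed
    show "\<exists>b\<in>I. \<forall>y\<in>Y. t y ` univ (D y) \<subseteq> t b ` univ (D b)" if Y: "Y \<subseteq> I" "|Y| <o cardSuc lam" for Y
    proof -
      have S_le: "B \<subseteq> univ X \<and> |B| \<le>o lam" if "B \<in> S" for B
        using that leD(4) by (auto simp: S_def)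
      \<comment> \<open>Fewer than \<open>cardSuc lam\<close> sets are at most \<open>lam\<close>
        many, each of size at most \<open>lam\<close>. Their union keeps this bound, and
        Loewenheim-Skolem yields one submodel above all of them.\<close>
      have "|\<Union>y\<in>Y. dec y| \<le>o lam"
        using Y less_cardSuc_lam dec S_le by (intro UNION_Cinfinite_bound[OF _ _ Cinfinite_lam]) auto
      moreover have "(\<Union>y\<in>Y. dec y) \<subseteq> univ X" using Y dec S_le by blast
      ultimately obtain N where "le N X" "(\<Union>y\<in>Y. dec y) \<subseteq> univ N" "|univ N| \<le>o lam"
        using Lowenheim_Skolem[OF X] by metis
      then have N: "univ N \<in> S" "\<And>y. y \<in> Y \<Longrightarrow> dec y \<subseteq> univ N" by (auto simp: S_def)
      have "t y ` univ (D y) \<subseteq> t (enc (univ N)) ` univ (D (enc (univ N)))" if "y \<in> Y" for y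
        using N(2)[OF that] im[OF subsetD[OF Y(1) that]] im[OF dec_enc(1)[OF N(1)]] dec_enc(2)[OF N(1)]
        by simp
      then show ?thesis using dec_enc(1)[OF N(1)] by blast
    qed
  qed
  then obtain r d where "directed_poset (cardSuc lam) I r" "diagram \<C> I r D d" "colimit \<C> I r D d X t"
    by blast
  with small_I Dt show ?thesis by (intro exI[of _ I] exI[of _ r] exI[of _ D] exI[of _ d] exI[of _ t]) simp
qed

lemma accessible: "accessible TYPE('u) (cardSuc lam) \<C>"
  unfolding accessible_def
proof (intro conjI allI impI; (elim conjE)?)
  have inf: "infinite (UNIV :: 'u set)" and reg: "regularCard |UNIV :: 'u set|"
    using closed_universe by (auto simp: closed_universe_def)
  have suc: "Cinfinite (cardSuc lam)" using Cinfinite_cardSuc[OF Cinfinite_lam] .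
  then show "cinfinite (cardSuc lam)" "Card_order (cardSuc lam)" by auto
  show "regularCard (cardSuc lam)" using regularCard_cardSuc[OF Cinfinite_lam] .
  show "cardSuc lam <o |UNIV :: 'u set|" by (rule cardSuc_lam_less)
  show "is_category \<C>" by (rule is_category)
  show "\<exists>c t. colimit \<C> I r D d c t"
    if "small TYPE('u) I" "directed_poset (cardSuc lam) I r" "diagram \<C> I r D d"
    for I :: "'u set" and r D d
    using ex_colimit[OF inf reg that(1) directed_poset_mono[OF that(2) mu_le_cardSuc_lam] that(3)] .
  \<comment> \<open>A small set representing all models of size at most \<open>lam\<close> up to
    isomorphism.\<close>
  let ?A = "{M \<in> K. univ M \<subseteq> Field lam}"
  have pres: "\<forall>M\<in>?A. presentable TYPE('u) (cardSuc lam) \<C> M"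
    using presentableI[OF suc mu_le_cardSuc_lam] less_cardSuc_lam le_lam_iff card_of_mono1 by blast
  have col: "\<forall>X\<in>Obj \<C>. \<exists>(I :: 'u set) r D d t. small TYPE('u) I \<and> directed_poset (cardSuc lam) I r \<and>
      diagram \<C> I r D d \<and> (\<forall>i\<in>I. D i \<in> ?A) \<and> colimit \<C> I r D d X t"
    using colimit_of_small by (simp add: \<C>_simps(1))
  show "\<exists>A. A \<subseteq> Obj \<C> \<and> small TYPE('u) A \<and> (\<forall>M\<in>A. presentable TYPE('u) (cardSuc lam) \<C> M) \<and>
      (\<forall>X\<in>Obj \<C>. \<exists>(I :: 'u set) r D d t. small TYPE('u) I \<and> directed_poset (cardSuc lam) I r \<and>
        diagram \<C> I r D d \<and> (\<forall>i\<in>I. D i \<in> A) \<and> colimit \<C> I r D d X t)"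
    by (rule exI[of _ ?A], intro conjI pres col small_structs) (auto simp: \<C>_simps(1))
qed

end

theorem theorem4p3:
  fixes mu :: "'k rel" and L :: "('f, 'r, 'k) language"
    and K :: "('f, 'r, 'k, 'u) struct set"
    and le :: "('f, 'r, 'k, 'u) struct \<Rightarrow> ('f, 'r, 'k, 'u) struct \<Rightarrow> bool"
    and lam :: "'u rel"
  assumes "closed_universe TYPE('u) lam"
    and "mu_AEC mu L K le"
    and "is_LS mu L K le lam"
  shows "accessible TYPE('u) (cardSuc lam) (AEC_cat mu L K le)"
proof -
  interpret AEC_LS mu L K le lam
    using assms by unfold_locales (auto simp: is_LS_def)
  show ?thesis by (rule accessible)
qed

end
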